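(* Any splittable subgroup of $G=\mathrm{SU}(2)^3$ acting freely on $M=G/\Delta(\mathrm{SU}(2))$ is, up to permutation of the three factors and conjugation in $G$, one in the following list: - $\mathbb{Z}_n\times 2I\times 2I$ with $2,3,5\nmid n$; - $\mathbb{Z}_n\times 2O\times 2I$, $\mathbb{Z}_n\times 2O\times 2O$, $\mathbb{Z}_n\times 2T\times 2O$, $\mathbb{Z}_n\times 2T\times 2I$, or $\mathbb{Z}_n\times 2T\times 2T$, with $2,3\nmid n$; - $\mathbb{Z}_n\times\mathbb{Z}_m\times\mathbb{Z}_l$ with $\gcd(n,m,l)=1$; - $\mathbb{Z}_n\times\mathbb{Z}_m\times 2D_{2l}$ with $\gcd(n,m,2l)=1$; - $\mathbb{Z}_n\times 2D_{2m}\times 2D_{2l}$ with $\gcd(n,2m,2l)=1$; - $\mathbb{Z}_n\times\mathbb{Z}_m\times 2T$ or $\mathbb{Z}_n\times\mathbb{Z}_m\times 2O$, with $2,3\nmid\gcd(n,m)$; - $\mathbb{Z}_n\times 2D_{2m}\times 2T$, $\mathbb{Z}_n\times 2D_{2m}\times 2O$, or $\mathbb{Z}_n\times 2D_{2m}\times 2I$, with $2,3\nmid\gcd(n,2m)$; - $\mathbb{Z}_n\times\mathbb{Z}_m\times 2I$ with $2,3,5\nmid\gcd(n,m)$.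
   Context: $\mathrm{SU}(2)$ is identified with the unit quaternions. $G=\mathrm{SU}(2)^3$, $K=\Delta(\mathrm{SU}(2))=\{(w,w,w)\}$, $M=G/K\cong S^3\times S^3$; subgroups of $G$ act on $M$ by left translation, and a subgroup acts freely if none of its non-trivial elements fixes a point. A finite subgroup of $G$ is splittable if it is of the form $A_1\times A_2\times A_3$ with non-trivial subgroups $A_i\subset\mathrm{SU}(2)$. Notation for finite subgroups of $\mathrm{SU}(2)$ (ADE groups): $\mathbb{Z}_n=\{e^{2\pi i x/n}:x\in\mathbb{Z}\}$, $n\ge2$; $2D_{2n}=\{e^{i\pi x/n}:x\in\mathbb{Z}\}\cup\{je^{i\pi x/n}:x\in\mathbb{Z}\}$, $n\ge2$ (order $4n$); $2T=2D_4\cup\{\tfrac12(\pm1\pm i\pm j\pm k)\}$ (order $24$); $2O=2T\cup e^{i\pi/4}\,2T$ (order $48$); $2I=\bigcup_{s=0}^4 q^s\,2T$ with $q=\frac12(\phi+\phi^{-1}i+j)$, $\phi=\frac{1+\sqrt5}{2}$ (order $120$). "$2,3\nmid N$" means that none of the listed primes divides $N$. *)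

theory Defs
  imports Complex_Main "HOL-Algebra.Left_Coset" "HOL-Combinatorics.Permutations"
begin

text \<open>\<open>Quat a b c d\<close> is the quaternion \<open>a + b i + c j + d k\<close>.\<close>

datatype quat = Quat (qRe: real) (qI: real) (qJ: real) (qK: real)

instantiation quat :: ring_1
begin

definition zero_quat :: quat where "0 = Quat 0 0 0 0"
definition one_quat :: quat where "1 = Quat 1 0 0 0"

definition plus_quat :: "quat \<Rightarrow> quat \<Rightarrow> quat" where
  "p + q = Quat (qRe p + qRe q) (qI p + qI q) (qJ p + qJ q) (qK p + qK q)"

definition minus_quat :: "quat \<Rightarrow> quat \<Rightarrow> quat" where
  "p - q = Quat (qRe p - qRe q) (qI p - qI q) (qJ p - qJ q) (qK p - qK q)"

definition uminus_quat :: "quat \<Rightarrow> quat" where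
  "- p = Quat (- qRe p) (- qI p) (- qJ p) (- qK p)"

definition times_quat :: "quat \<Rightarrow> quat \<Rightarrow> quat" where
  "p * q = Quat
     (qRe p * qRe q - qI p * qI q - qJ p * qJ q - qK p * qK q)
     (qRe p * qI q + qI p * qRe q + qJ p * qK q - qK p * qJ q)
     (qRe p * qJ q - qI p * qK q + qJ p * qRe q + qK p * qI q)
     (qRe p * qK q + qI p * qJ q - qJ p * qI q + qK p * qRe q)"

instance
  by standard
    (simp_all add: zero_quat_def one_quat_def plus_quat_def minus_quat_def uminus_quat_def
      times_quat_def algebra_simps)

end

definition quat_of_complex :: "complex \<Rightarrow> quat" where
  "quat_of_complex z = Quat (Re z) (Im z) 0 0"

definition quat_j :: quat where "quat_j = Quat 0 0 1 0"

definition unit_quaternions :: "quat set" where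
  "unit_quaternions = {q. (qRe q)\<^sup>2 + (qI q)\<^sup>2 + (qJ q)\<^sup>2 + (qK q)\<^sup>2 = 1}"

text \<open>SU(2) is identified with the unit quaternions.\<close>

definition SU2 :: "quat monoid" where
  "SU2 = \<lparr>carrier = unit_quaternions, monoid.mult = (*), one = 1\<rparr>"

lemma group_SU2: "group SU2"
proof (rule groupI)
  fix x y assume "x \<in> carrier SU2" "y \<in> carrier SU2"
  then have "(qRe x)\<^sup>2 + (qI x)\<^sup>2 + (qJ x)\<^sup>2 + (qK x)\<^sup>2 = 1"
    and "(qRe y)\<^sup>2 + (qI y)\<^sup>2 + (qJ y)\<^sup>2 + (qK y)\<^sup>2 = 1"
    by (simp_all add: SU2_def unit_quaternions_def)
  moreover have "(qRe (x * y))\<^sup>2 + (qI (x * y))\<^sup>2 + (qJ (x * y))\<^sup>2 + (qK (x * y))\<^sup>2 =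
      ((qRe x)\<^sup>2 + (qI x)\<^sup>2 + (qJ x)\<^sup>2 + (qK x)\<^sup>2) * ((qRe y)\<^sup>2 + (qI y)\<^sup>2 + (qJ y)\<^sup>2 + (qK y)\<^sup>2)"
    by (simp add: times_quat_def) algebra
  ultimately show "x \<otimes>\<^bsub>SU2\<^esub> y \<in> carrier SU2"
    by (simp add: SU2_def unit_quaternions_def)
next
  show "\<one>\<^bsub>SU2\<^esub> \<in> carrier SU2"
    by (simp add: SU2_def unit_quaternions_def one_quat_def)
next
  fix x assume x: "x \<in> carrier SU2"
  let ?y = "Quat (qRe x) (- qI x) (- qJ x) (- qK x)"
  have "?y \<in> carrier SU2" and "?y \<otimes>\<^bsub>SU2\<^esub> x = \<one>\<^bsub>SU2\<^esub>"
    using x by (auto simp: SU2_def unit_quaternions_def one_quat_def times_quat_def power2_eq_square)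
  then show "\<exists>y\<in>carrier SU2. y \<otimes>\<^bsub>SU2\<^esub> x = \<one>\<^bsub>SU2\<^esub>" by blast
qed (auto simp: SU2_def mult.assoc)

definition SU2_cubed :: "(quat \<times> quat \<times> quat) monoid" where
  "SU2_cubed = SU2 \<times>\<times> (SU2 \<times>\<times> SU2)"

definition diagonal_SU2 :: "(quat \<times> quat \<times> quat) set" where
  "diagonal_SU2 = {(w, w, w) | w. w \<in> carrier SU2}"

lemma group_SU2_cubed: "group SU2_cubed"
  unfolding SU2_cubed_def by (intro DirProd_group group_SU2)

lemma subgroup_diagonal_SU2: "subgroup diagonal_SU2 SU2_cubed"
proof (rule group.subgroupI[OF group_SU2_cubed])
  interpret SU2: group SU2 by (rule group_SU2)
  show "diagonal_SU2 \<subseteq> carrier SU2_cubed" and "diagonal_SU2 \<noteq> {}"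
    by (auto simp: diagonal_SU2_def SU2_cubed_def)
  show "inv\<^bsub>SU2_cubed\<^esub> a \<in> diagonal_SU2" if "a \<in> diagonal_SU2" for a
    using that by (auto simp: diagonal_SU2_def SU2_cubed_def inv_DirProd group_SU2 DirProd_group)
  show "a \<otimes>\<^bsub>SU2_cubed\<^esub> b \<in> diagonal_SU2" if "a \<in> diagonal_SU2" "b \<in> diagonal_SU2" for a b
    using that by (auto simp: diagonal_SU2_def SU2_cubed_def)
qed

text \<open>\<open>M = G/K\<close> for the diagonal \<open>K\<close>; left translation by \<open>g\<close> sends a coset \<open>x\<close> to \<open>g <# x\<close>.\<close>

definition coset_space_M :: "(quat \<times> quat \<times> quat) set set" where
  "coset_space_M = lcosets\<^bsub>SU2_cubed\<^esub> diagonal_SU2"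

definition acts_freely_on_M :: "(quat \<times> quat \<times> quat) set \<Rightarrow> bool" where
  "acts_freely_on_M \<Gamma> \<longleftrightarrow>
     (\<forall>g\<in>\<Gamma>. g \<noteq> \<one>\<^bsub>SU2_cubed\<^esub> \<longrightarrow> (\<forall>x\<in>coset_space_M. g <#\<^bsub>SU2_cubed\<^esub> x \<noteq> x))"

definition splittable :: "(quat \<times> quat \<times> quat) set \<Rightarrow> bool" where
  "splittable \<Gamma> \<longleftrightarrow> finite \<Gamma> \<and> subgroup \<Gamma> SU2_cubed \<and>
     (\<exists>A1 A2 A3. subgroup A1 SU2 \<and> subgroup A2 SU2 \<and> subgroup A3 SU2 \<and>
        A1 \<noteq> {\<one>\<^bsub>SU2\<^esub>} \<and> A2 \<noteq> {\<one>\<^bsub>SU2\<^esub>} \<and> A3 \<noteq> {\<one>\<^bsub>SU2\<^esub>} \<and>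
        \<Gamma> = A1 \<times> A2 \<times> A3)"

fun factor :: "'a \<times> 'a \<times> 'a \<Rightarrow> nat \<Rightarrow> 'a" where
  "factor (x, y, z) i = (if i = 1 then x else if i = 2 then y else z)"

definition permute_factors :: "(nat \<Rightarrow> nat) \<Rightarrow> 'a \<times> 'a \<times> 'a \<Rightarrow> 'a \<times> 'a \<times> 'a" where
  "permute_factors \<sigma> x = (factor x (\<sigma> 1), factor x (\<sigma> 2), factor x (\<sigma> 3))"

definition equal_up_to_permutation_and_conjugation ::
  "(quat \<times> quat \<times> quat) set \<Rightarrow> (quat \<times> quat \<times> quat) set \<Rightarrow> bool" where
  "equal_up_to_permutation_and_conjugation \<Gamma> \<Gamma>' \<longleftrightarrow>
     (\<exists>\<sigma>. \<sigma> permutes {1, 2, 3} \<and>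
       (\<exists>g\<in>carrier SU2_cubed.
         \<Gamma>' = (\<lambda>x. g \<otimes>\<^bsub>SU2_cubed\<^esub> x \<otimes>\<^bsub>SU2_cubed\<^esub> inv\<^bsub>SU2_cubed\<^esub> g) ` permute_factors \<sigma> ` \<Gamma>))"

definition cyclic_Z :: "nat \<Rightarrow> quat set" where
  "cyclic_Z n = {quat_of_complex (cis (2 * pi * real_of_int x / real n)) | x. True}"

text \<open>\<open>two_D n\<close> is the group \<open>2D\<^bsub>2n\<^esub>\<close> of order \<open>4n\<close>: the parameter is \<open>n\<close>, not the index \<open>2n\<close>.\<close>

definition two_D :: "nat \<Rightarrow> quat set" where
  "two_D n = {quat_of_complex (cis (pi * real_of_int x / real n)) | x. True} \<union>
             {quat_j * quat_of_complex (cis (pi * real_of_int x / real n)) | x. True}"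

definition two_T :: "quat set" where
  "two_T = two_D 2 \<union> {Quat a b c d | a b c d. {a, b, c, d} \<subseteq> {1/2, -1/2}}"

definition two_O :: "quat set" where
  "two_O = two_T \<union> (\<lambda>t. quat_of_complex (cis (pi / 4)) * t) ` two_T"

definition golden_ratio :: real where "golden_ratio = (1 + sqrt 5) / 2"

definition icosian_q :: quat where
  "icosian_q = Quat (golden_ratio / 2) (inverse golden_ratio / 2) (1/2) 0"

definition two_I :: "quat set" where
  "two_I = (\<Union>s\<in>{0..4::nat}. (\<lambda>t. icosian_q ^ s * t) ` two_T)"

end

theory Submission
  imports Defs
begin

text \<open>
An element \<open>(a\<^sub>1, a\<^sub>2, a\<^sub>3)\<close> fixes a point of \<open>M\<close> exactly when \<open>a\<^sub>1, a\<^sub>2, a\<^sub>3\<close> are conjugate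
to one and the same unit quaternion, and unit quaternions are conjugate exactly when their
real parts agree. So if \<open>A\<^sub>1 \<times> A\<^sub>2 \<times> A\<^sub>3\<close> acts freely, no real part other than 1 occurs in all
three factors (\<open>free_action_no_common_qRe\<close>). Each \<open>A\<^sub>i\<close> can be conjugated to one of the ADE
models (\<open>conj_to_ade_model_of_nontrivial\<close>), which does not change its real parts. All models
except the cyclic groups of odd order contain \<open>-1\<close>, so one factor is such a group; it is moved
to the first place, and the other two factors are sorted by type. If \<open>p\<close> divides the orders of
cyclic subgroups of all three models, then \<open>cos (2\<pi>/p)\<close> is a common real part; this rules out
every common divisor and gives the arithmetic conditions of the list
(\<open>listed_of_sorted_kinds\<close>).

The main part is the classification of the finite groups \<open>A\<close> of unit quaternions. After
adjoining \<open>-1\<close>, let \<open>c < 1\<close> be the largest real part of an element other than 1. A finite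
group of complex numbers of modulus 1 is generated by its smallest angle, so \<open>c = cos (\<pi>/n)\<close>,
and all real parts in \<open>A\<close> have the form \<open>cos (k\<pi>/m)\<close> with \<open>m \<le> n\<close>. Fix \<open>g\<close> with real part \<open>c\<close>.

If all conjugates of \<open>g\<close> in \<open>A\<close> are \<open>g\<close> or \<open>g\<^sup>-\<^sup>1\<close>, the axis of \<open>g\<close> is preserved and \<open>A\<close> is
cyclic or binary dihedral; for \<open>n = 1\<close> it is \<open>{1, -1}\<close>. Otherwise take a conjugate \<open>h\<close> with
another axis. For \<open>n \<ge> 6\<close> this is impossible by the argument of the crystallographic
restriction: among all pairs \<open>g, h\<close> of elements with real part \<open>c\<close> and different axes choose
one whose axes are closest; rotating the axis of \<open>h\<close> about that of \<open>g\<close> by the angle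
\<open>2\<pi>/n \<le> \<pi>/3\<close> moves it by less than their distance (\<open>unique_axis_of_small_rotation\<close>). For
\<open>n = 2\<close> a second axis is orthogonal to the first, so that the axis of \<open>g\<close> is preserved. For
\<open>n = 3, 4, 5\<close> the real parts of \<open>g h\<close> and \<open>g h\<^sup>-\<^sup>1\<close> both lie in the short list of values
above, and this leaves one possible angle between the axes. The pair \<open>(g, h)\<close> is then
conjugate to a standard pair of generators, because two unit quaternions are determined up to
conjugation by their real parts and their inner product (\<open>conj_pair\<close>). Hence \<open>A\<close> contains a
conjugate of \<open>2T\<close>, \<open>2O\<close> or \<open>2I\<close>.

For the converse inclusion, every unit quaternion is within 45 degrees of an element of \<open>2T\<close>
(\<open>two_T_covering\<close>). So each \<open>x\<close> in \<open>A\<close> has a translate \<open>x t\<close> with \<open>t\<close> in \<open>2T\<close> whose real part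
is at least \<open>\<surd>2/2\<close>; it is 1, or it is \<open>c\<close> (for \<open>n = 5\<close> the value \<open>\<surd>2/2\<close> is excluded by
\<open>no_order_8_with_order_10\<close>) and the axis of \<open>x t\<close> makes only the permitted angles with the
standard axes, which forces it to be one of them.
\<close>

section \<open>Unit quaternions and conjugation\<close>

lemma quat_sel [simp]:
  "qRe (p * q) = qRe p * qRe q - qI p * qI q - qJ p * qJ q - qK p * qK q"
  "qI (p * q) = qRe p * qI q + qI p * qRe q + qJ p * qK q - qK p * qJ q"
  "qJ (p * q) = qRe p * qJ q - qI p * qK q + qJ p * qRe q + qK p * qI q"
  "qK (p * q) = qRe p * qK q + qI p * qJ q - qJ p * qI q + qK p * qRe q"
  "qRe 0 = 0" "qI 0 = 0" "qJ 0 = 0" "qK 0 = 0"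
  "qRe 1 = 1" "qI 1 = 0" "qJ 1 = 0" "qK 1 = 0"
  "qRe (p + q) = qRe p + qRe q" "qI (p + q) = qI p + qI q"
  "qJ (p + q) = qJ p + qJ q" "qK (p + q) = qK p + qK q"
  "qRe (- p) = - qRe p" "qI (- p) = - qI p" "qJ (- p) = - qJ p" "qK (- p) = - qK p"
  by (simp_all add: times_quat_def zero_quat_def one_quat_def plus_quat_def uminus_quat_def)

lemma quat_of_complex_sel [simp]:
  "qRe (quat_of_complex z) = Re z" "qI (quat_of_complex z) = Im z"
  "qJ (quat_of_complex z) = 0" "qK (quat_of_complex z) = 0"
  by (simp_all add: quat_of_complex_def)

lemma quat_j_sel [simp]: "qRe quat_j = 0" "qI quat_j = 0" "qJ quat_j = 1" "qK quat_j = 0"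
  by (simp_all add: quat_j_def)

lemma quat_eq_iff: "p = q \<longleftrightarrow> qRe p = qRe q \<and> qI p = qI q \<and> qJ p = qJ q \<and> qK p = qK q"
  by (auto intro: quat.expand)

lemma quat_of_complex_mult: "quat_of_complex z * quat_of_complex w = quat_of_complex (z * w)"
  by (simp add: quat_eq_iff)

definition qcnj :: "quat \<Rightarrow> quat" where
  "qcnj q = Quat (qRe q) (- qI q) (- qJ q) (- qK q)"

lemma qcnj_sel [simp]:
  "qRe (qcnj q) = qRe q" "qI (qcnj q) = - qI q" "qJ (qcnj q) = - qJ q" "qK (qcnj q) = - qK q"
  by (simp_all add: qcnj_def)

lemma qcnj_mult: "qcnj (p * q) = qcnj q * qcnj p"
  by (simp add: quat_eq_iff algebra_simps)

lemma qcnj_qcnj [simp]: "qcnj (qcnj q) = q"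
  by (simp add: quat_eq_iff)

lemma qcnj_quat_of_complex: "qcnj (quat_of_complex z) = quat_of_complex (cnj z)"
  by (simp add: quat_eq_iff)

lemma unit_iff:
  "q \<in> unit_quaternions \<longleftrightarrow> (qRe q)\<^sup>2 + (qI q)\<^sup>2 + (qJ q)\<^sup>2 + (qK q)\<^sup>2 = 1"
  by (simp add: unit_quaternions_def)

lemma carrier_SU2: "carrier SU2 = unit_quaternions"
  by (simp add: SU2_def)

lemma unit_mult [intro]:
  "p \<in> unit_quaternions \<Longrightarrow> q \<in> unit_quaternions \<Longrightarrow> p * q \<in> unit_quaternions"
  using group.is_monoid[OF group_SU2] monoid.m_closed by (fastforce simp: SU2_def)

lemma unit_qcnj [simp]: "qcnj p \<in> unit_quaternions \<longleftrightarrow> p \<in> unit_quaternions"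
  by (simp add: unit_iff)

lemma unit_one [simp]: "1 \<in> unit_quaternions"
  by (simp add: unit_iff)

lemma unit_quat_of_complex: "quat_of_complex z \<in> unit_quaternions \<longleftrightarrow> norm z = 1"
  by (simp add: unit_iff cmod_def)

lemma unit_qcnj_mult [simp]:
  assumes "p \<in> unit_quaternions"
  shows "p * qcnj p = 1" "qcnj p * p = 1"
  using assms by (auto simp: unit_iff quat_eq_iff power2_eq_square algebra_simps)

lemma unit_cancel [simp]:
  assumes "p \<in> unit_quaternions"
  shows "p * (qcnj p * x) = x" "qcnj p * (p * x) = x"
  using assms by (simp_all flip: mult.assoc)

lemma unit_qRe_eq_1:
  assumes "p \<in> unit_quaternions" "qRe p = 1"
  shows "p = 1"
  using assms unfolding unit_iff quat_eq_iff by (simp add: sum_power2_eq_zero_iff add_nonneg_eq_0_iff)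

lemma unit_qRe_eq_minus_1:
  assumes "p \<in> unit_quaternions" "qRe p = -1"
  shows "p = -1"
  using assms unfolding unit_iff quat_eq_iff by (simp add: sum_power2_eq_zero_iff add_nonneg_eq_0_iff)

definition qconj :: "quat \<Rightarrow> quat \<Rightarrow> quat" where
  "qconj w x = w * x * qcnj w"

lemma qRe_mult_commute: "qRe (p * q) = qRe (q * p)"
  by simp

lemma qRe_qconj [simp]: "w \<in> unit_quaternions \<Longrightarrow> qRe (qconj w x) = qRe x"
  unfolding qconj_def by (subst qRe_mult_commute) (simp del: quat_sel)

lemma qconj_mult: "w \<in> unit_quaternions \<Longrightarrow> qconj w (x * y) = qconj w x * qconj w y"
  by (simp add: qconj_def mult.assoc)

lemma qconj_qcnj: "qconj w (qcnj x) = qcnj (qconj w x)"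
  by (simp add: qconj_def qcnj_mult mult.assoc)

lemma qconj_qconj: "qconj v (qconj w x) = qconj (v * w) x"
  by (simp add: qconj_def qcnj_mult mult.assoc)

lemma qconj_one [simp]: "w \<in> unit_quaternions \<Longrightarrow> qconj w 1 = 1"
  by (simp add: qconj_def)

lemma qconj_uminus: "qconj w (- x) = - qconj w x"
  by (simp add: qconj_def)

lemma qconj_by_one: "qconj 1 x = x"
  by (simp add: qconj_def quat_eq_iff)

lemma qconj_inverse [simp]:
  "w \<in> unit_quaternions \<Longrightarrow> qconj (qcnj w) (qconj w x) = x"
  by (simp add: qconj_qconj qconj_by_one)

lemma unit_qconj [intro]:
  "w \<in> unit_quaternions \<Longrightarrow> x \<in> unit_quaternions \<Longrightarrow> qconj w x \<in> unit_quaternions"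
  unfolding qconj_def by (intro unit_mult) simp_all

text \<open>Any imaginary direction can be rotated to that of \<open>i\<close>. Hence the real part of a unit
quaternion determines its conjugacy class.\<close>

lemma conj_imaginary_to_complex:
  assumes "g \<in> unit_quaternions"
  shows "\<exists>w\<in>unit_quaternions. qconj w g = Quat (qRe g) (sqrt (1 - (qRe g)\<^sup>2)) 0 0"
proof -
  define s where "s = sqrt (1 - (qRe g)\<^sup>2)"
  have s2: "(qI g)\<^sup>2 + (qJ g)\<^sup>2 + (qK g)\<^sup>2 = s\<^sup>2" and s0: "0 \<le> s"
  proof -
    have e: "(qI g)\<^sup>2 + (qJ g)\<^sup>2 + (qK g)\<^sup>2 = 1 - (qRe g)\<^sup>2"
      using assms by (simp add: unit_iff)
    then have "0 \<le> 1 - (qRe g)\<^sup>2"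
      by (metis add_nonneg_nonneg zero_le_power2)
    then show "(qI g)\<^sup>2 + (qJ g)\<^sup>2 + (qK g)\<^sup>2 = s\<^sup>2" "0 \<le> s"
      by (simp_all add: s_def e)
  qed
  show ?thesis
  proof (cases "qJ g = 0 \<and> qK g = 0")
    case True
    then have "qI g = s \<or> qI g = - s"
      using s2 by (simp add: power2_eq_iff)
    then show ?thesis
    proof
      assume "qI g = s"
      then have "qconj 1 g = Quat (qRe g) s 0 0"
        using True by (simp add: qconj_by_one quat_eq_iff)
      then show ?thesis unfolding s_def by (intro bexI[of _ 1]) simp_all
    next
      assume "qI g = - s"
      then have "qconj quat_j g = Quat (qRe g) s 0 0"
        using True by (simp add: qconj_def quat_eq_iff)
      moreover have "quat_j \<in> unit_quaternions" by (simp add: unit_iff)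
      ultimately show ?thesis unfolding s_def by (intro bexI[of _ quat_j]) simp_all
    qed
  next
    case False
    define b c d where "b = qI g" and "c = qJ g" and "d = qK g"
    have e: "b\<^sup>2 + c\<^sup>2 + d\<^sup>2 = s\<^sup>2"
      using s2 by (simp add: b_def c_def d_def)
    define N where "N = (s + b)\<^sup>2 + c\<^sup>2 + d\<^sup>2"
    have "c\<^sup>2 + d\<^sup>2 \<noteq> 0" using False by (simp add: c_def d_def sum_power2_eq_zero_iff)
    then have N: "N > 0" unfolding N_def
      by (metis add.assoc add_nonneg_eq_0_iff add_pos_nonneg not_sum_power2_lt_zero
          order_less_le zero_le_power2 linorder_neqE_linordered_idom add_nonneg_pos)
    define r where "r = 1 / sqrt N"
    have r: "r * r * N = 1" using N by (simp add: r_def)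
    \<comment> \<open>For imaginary \<open>u\<close>, \<open>v\<close> of equal length, \<open>w = |u|\<^sup>2 - v u\<close> satisfies \<open>w u = v w\<close>; here
      \<open>v = s i\<close>, and \<open>w\<close> is divided by \<open>s\<close> and normalised.\<close>
    define w where "w = Quat (r * (s + b)) 0 (r * d) (- (r * c))"
    have w: "w \<in> unit_quaternions"
      using r unfolding unit_iff w_def N_def
      by (simp add: power2_eq_square algebra_simps)
    have "w * g = Quat (qRe g) s 0 0 * w"
      using e unfolding quat_eq_iff w_def
      by (simp flip: b_def c_def d_def) (simp add: power2_eq_square algebra_simps; algebra)
    then have "qconj w g = Quat (qRe g) s 0 0"
      using w by (simp add: qconj_def mult.assoc)
    then show ?thesis unfolding s_def using w by (intro bexI[of _ w]) simp_all
  qed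
qed

text \<open>The complex numbers of modulus 1 rotate about the axis \<open>i\<close>: on the plane spanned by \<open>j\<close> and
\<open>k\<close>, identified with the complex numbers, \<open>z\<close> acts as multiplication by \<open>z\<^sup>2\<close>.\<close>

lemma qconj_by_complex:
  fixes h :: quat and z :: complex
  defines "h' \<equiv> qconj (quat_of_complex z) h"
  assumes "norm z = 1"
  shows "qRe h' = qRe h" "qI h' = qI h" "Complex (qJ h') (qK h') = z\<^sup>2 * Complex (qJ h) (qK h)"
proof -
  obtain a b where z: "z = Complex a b" by (cases z)
  have ab: "a\<^sup>2 + b\<^sup>2 = 1" using assms(2) by (simp add: z cmod_def)
  show "qRe h' = qRe h"
    unfolding h'_def using assms(2) by (simp add: unit_quat_of_complex)
  have "qI h' = (a\<^sup>2 + b\<^sup>2) * qI h"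
    unfolding h'_def qconj_def z by (simp add: power2_eq_square algebra_simps)
  then show "qI h' = qI h" using ab by simp
  show "Complex (qJ h') (qK h') = z\<^sup>2 * Complex (qJ h) (qK h)"
    unfolding h'_def qconj_def z by (simp add: complex_eq_iff power2_eq_square algebra_simps)
qed

lemma exists_half_rotation:
  fixes z :: complex
  shows "\<exists>w. norm w = 1 \<and> w\<^sup>2 * z = of_real (norm z)"
proof (cases "z = 0")
  case True
  then show ?thesis by (intro exI[of _ 1]) simp
next
  case False
  define w where "w = csqrt (cnj (sgn z))"
  have w2: "w\<^sup>2 = cnj (sgn z)" by (simp add: w_def)
  have "(norm w)\<^sup>2 = 1"
    by (metis w2 False complex_mod_cnj norm_power norm_sgn)
  then have "norm w = 1" by (simp add: power2_eq_1_iff) (metis norm_ge_zero not_one_le_zero le_minus_iff neg_0_le_iff_le order_trans zero_le_one)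
  moreover have "w\<^sup>2 * z = of_real (norm z)"
    using False unfolding w2 sgn_eq
    by (simp add: field_simps complex_norm_square[symmetric] power2_eq_square)
  ultimately show ?thesis by blast
qed

text \<open>Rotate the axis of \<open>g\<close> to \<open>i\<close>, then rotate about \<open>i\<close> until the axis of \<open>h\<close> lies in the half
plane spanned by \<open>i\<close> and \<open>j\<close>.\<close>

lemma conj_pair_normal_form:
  assumes "g \<in> unit_quaternions" "h \<in> unit_quaternions"
  shows "\<exists>w\<in>unit_quaternions. \<exists>x y. 0 \<le> y \<and>
    qconj w g = Quat (qRe g) (sqrt (1 - (qRe g)\<^sup>2)) 0 0 \<and> qconj w h = Quat (qRe h) x y 0"
proof -
  obtain v where v: "v \<in> unit_quaternions"
    "qconj v g = Quat (qRe g) (sqrt (1 - (qRe g)\<^sup>2)) 0 0"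
    using conj_imaginary_to_complex[OF assms(1)] by blast
  define h1 where "h1 = qconj v h"
  obtain z where z: "norm z = 1"
    "z\<^sup>2 * Complex (qJ h1) (qK h1) = of_real (norm (Complex (qJ h1) (qK h1)))"
    using exists_half_rotation by blast
  define u where "u = quat_of_complex z"
  have u: "u \<in> unit_quaternions" by (simp add: u_def unit_quat_of_complex z)
  have "qconj u (qconj v g) = qconj v g"
    unfolding u_def quat_eq_iff using qconj_by_complex[OF z(1), of "qconj v g"]
    by (simp add: v(2) complex_eq_iff)
  moreover have "qconj u h1 = Quat (qRe h) (qI h1) (norm (Complex (qJ h1) (qK h1))) 0"
    unfolding u_def quat_eq_iff using qconj_by_complex[OF z(1), of h1] z(2) v(1)
    by (simp add: h1_def complex_eq_iff)
  ultimately show ?thesis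
    using u v by (intro bexI[of _ "u * v"] exI[of _ "qI h1"]
        exI[of _ "norm (Complex (qJ h1) (qK h1))"])
      (auto simp: h1_def simp flip: qconj_qconj)
qed

text \<open>The normal form of a pair is determined by the three given real numbers, as long as \<open>g\<close> has an
axis, that is \<open>g \<noteq> \<plusminus>1\<close>.\<close>

lemma conj_pair:
  assumes "g \<in> unit_quaternions" "h \<in> unit_quaternions" "g' \<in> unit_quaternions" "h' \<in> unit_quaternions"
    and "qRe g = qRe g'" "qRe h = qRe h'" "qRe (g * qcnj h) = qRe (g' * qcnj h')"
    and "(qRe g)\<^sup>2 \<noteq> 1"
  shows "\<exists>w\<in>unit_quaternions. qconj w g = g' \<and> qconj w h = h'"
proof -
  define s where "s = sqrt (1 - (qRe g)\<^sup>2)"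
  have s: "s \<noteq> 0" using assms(8) by (simp add: s_def)
  obtain w x y where w: "w \<in> unit_quaternions" "0 \<le> y"
    "qconj w g = Quat (qRe g) s 0 0" "qconj w h = Quat (qRe h) x y 0"
    using conj_pair_normal_form[OF assms(1,2)] unfolding s_def by blast
  obtain w' x' y' where w': "w' \<in> unit_quaternions" "0 \<le> y'"
    "qconj w' g' = Quat (qRe g) s 0 0" "qconj w' h' = Quat (qRe h) x' y' 0"
    using conj_pair_normal_form[OF assms(3,4)] unfolding s_def assms(5,6) by blast
  have "qRe (g * qcnj h) = qRe (qconj w g * qcnj (qconj w h))"
    using w(1) by (simp flip: qconj_mult qconj_qcnj del: quat_sel)
  moreover have "qRe (g' * qcnj h') = qRe (qconj w' g' * qcnj (qconj w' h'))"
    using w'(1) by (simp flip: qconj_mult qconj_qcnj del: quat_sel)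
  ultimately have "s * x = s * x'"
    using assms(7) by (simp add: w w')
  then have x: "x = x'" using s by simp
  have "qconj w h \<in> unit_quaternions" "qconj w' h' \<in> unit_quaternions"
    using unit_qconj assms(2,4) w(1) w'(1) by blast+
  then have "(qRe h)\<^sup>2 + x\<^sup>2 + y\<^sup>2 = 1" "(qRe h)\<^sup>2 + x\<^sup>2 + y'\<^sup>2 = 1"
    unfolding w w' unit_iff x by simp_all
  then have "y\<^sup>2 = y'\<^sup>2" by linarith
  then have y: "y = y'" using w(2) w'(2) by simp
  have "qconj (qcnj w' * w) g = g'" "qconj (qcnj w' * w) h = h'"
    using w' w x y unfolding qconj_qconj[symmetric] by (metis qconj_inverse)+
  then show ?thesis using w w' by (intro bexI[of _ "qcnj w' * w"]) auto
qed

section \<open>Finite groups of unit quaternions\<close>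

locale finite_unit_group =
  fixes A :: "quat set"
  assumes finite: "finite A"
    and unit: "A \<subseteq> unit_quaternions"
    and one: "1 \<in> A"
    and mult: "x \<in> A \<Longrightarrow> y \<in> A \<Longrightarrow> x * y \<in> A"
    and qcnj: "x \<in> A \<Longrightarrow> qcnj x \<in> A"
begin

lemma is_unit: "x \<in> A \<Longrightarrow> x \<in> unit_quaternions"
  using unit by blast

lemma qconj_image:
  assumes w: "w \<in> unit_quaternions"
  shows "finite_unit_group (qconj w ` A)"
proof
  show "finite (qconj w ` A)" using finite by simp
  show "qconj w ` A \<subseteq> unit_quaternions" using unit w by auto
  show "1 \<in> qconj w ` A" using one w by (metis imageI qconj_one)
  show "x * y \<in> qconj w ` A" if "x \<in> qconj w ` A" "y \<in> qconj w ` A" for x y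
    using that w mult by (auto simp flip: qconj_mult)
  show "qcnj x \<in> qconj w ` A" if "x \<in> qconj w ` A" for x
    using that qcnj by (auto simp flip: qconj_qcnj)
qed

lemma conjugation_closed: "x \<in> A \<Longrightarrow> y \<in> A \<Longrightarrow> qconj x y \<in> A"
  unfolding qconj_def by (intro mult qcnj)

text \<open>The angles of the complex elements form a discrete subgroup of the real line, generated by its
least positive element \<open>d\<close>; as it contains \<open>2\<pi>\<close>, this \<open>d\<close> is \<open>2\<pi>/m\<close>.\<close>

lemma complex_part_cyclic:
  "\<exists>m\<ge>1. {x \<in> A. qJ x = 0 \<and> qK x = 0} = cyclic_Z m"
proof -
  define H where "H = {t. quat_of_complex (cis t) \<in> A}"
  have H_add: "s + t \<in> H" if "s \<in> H" "t \<in> H" for s t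
    using that mult by (simp add: H_def flip: cis_mult quat_of_complex_mult)
  have H_minus: "- t \<in> H" if "t \<in> H" for t
    using that qcnj by (simp add: H_def flip: cis_cnj qcnj_quat_of_complex)
  have H_nat: "of_nat n * t \<in> H" if "t \<in> H" for n t
  proof (induction n)
    case 0
    show ?case using one by (simp add: H_def quat_of_complex_def one_quat_def)
  next
    case (Suc n)
    then show ?case using H_add[OF that Suc] by (simp add: algebra_simps)
  qed
  have H_int: "of_int k * t \<in> H" if "t \<in> H" for k t
  proof (cases k)
    case (nonneg n)
    then show ?thesis using H_nat[OF that] by simp
  next
    case (neg n)
    then have "real_of_int k = - real (Suc n)" by simp
    then have "of_int k * t = of_nat (Suc n) * (- t)" by (simp only: mult_minus_left mult_minus_right)
    then show ?thesis using H_nat[OF H_minus[OF that], of "Suc n"] by simp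
  qed
  have pi_H: "2 * pi \<in> H"
    using one by (simp add: H_def quat_of_complex_def one_quat_def)
  define P where "P = H \<inter> {0<..2 * pi}"
  have "inj_on (\<lambda>t. quat_of_complex (cis t)) {0<..2 * pi}"
  proof (rule inj_onI)
    fix s t assume st: "s \<in> {0<..2 * pi}" "t \<in> {0<..2 * pi}"
      and "quat_of_complex (cis s) = quat_of_complex (cis t)"
    then have "cos s = cos t" "sin s = sin t" by (simp_all add: quat_eq_iff)
    then have "cos (s - t) = 1"
      by (metis cos_diff sin_cos_squared_add3)
    then obtain n :: int where n: "s - t = n * 2 * pi"
      by (auto simp: cos_one_2pi_int)
    then have e: "of_int n * (2 * pi) = s - t" by simp
    have "\<bar>of_int n * (2 * pi)\<bar> < 1 * (2 * pi)" unfolding e using st by (auto simp: abs_less_iff)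
    then have "\<bar>real_of_int n\<bar> < 1" by (simp add: abs_mult)
    then have "n = 0" by linarith
    then show "s = t" using n by simp
  qed
  moreover have "(\<lambda>t. quat_of_complex (cis t)) ` P \<subseteq> A" by (auto simp: P_def H_def)
  ultimately have "finite P"
    using finite by (metis P_def finite_imageD finite_subset inf_le2 inj_on_subset)
  moreover have "P \<noteq> {}" using pi_H by (auto simp: P_def)
  ultimately obtain d where d: "d \<in> P" "\<And>t. t \<in> P \<Longrightarrow> d \<le> t"
    using Min_in Min_le by metis
  have d0: "0 < d" "d \<le> 2 * pi" and dH: "d \<in> H" using d by (auto simp: P_def)
  have multiple: "\<exists>k::int. t = k * d" if "t \<in> H" for t
  proof -
    define k where "k = \<lfloor>t / d\<rfloor>"
    define r where "r = t - k * d"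
    have "r \<in> H" using H_add[OF that H_minus[OF H_int[OF dH, of k]]] by (simp add: r_def)
    moreover have "k * d \<le> t" "t < (k + 1) * d"
      using floor_correct[of "t / d"] d0
      by (simp_all only: k_def pos_le_divide_eq pos_divide_less_eq of_int_add of_int_1)
    then have "0 \<le> r" "r < d" by (simp_all add: r_def algebra_simps)
    ultimately have "r = 0" using d d0 by (force simp: P_def)
    then show ?thesis by (auto simp: r_def)
  qed
  obtain l :: int where l: "2 * pi = l * d" using multiple[OF pi_H] by blast
  have "l > 0" using l d0 by (metis mult_less_0_iff of_int_0_less_iff pi_gt_zero zero_less_mult_iff zero_less_numeral order_less_asym)
  then obtain m where m: "l = int m" "m \<ge> 1" by (metis One_nat_def Suc_leI gr0_conv_Suc zero_less_imp_eq_int)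
  have dm: "d = 2 * pi / m" using l m by (simp add: field_simps)
  have "{x \<in> A. qJ x = 0 \<and> qK x = 0} = cyclic_Z m"
  proof (rule Set.set_eqI, rule iffI)
    fix x assume x: "x \<in> {x \<in> A. qJ x = 0 \<and> qK x = 0}"
    then have "x \<in> unit_quaternions" using is_unit by blast
    then have "(qRe x)\<^sup>2 + (qI x)\<^sup>2 = 1" using x by (simp add: unit_iff)
    then obtain t where t: "qRe x = cos t" "qI x = sin t" using sincos_total_2pi by metis
    have xt: "x = quat_of_complex (cis t)" using x t by (simp add: quat_eq_iff)
    then have "t \<in> H" using x by (simp add: H_def)
    then obtain k :: int where "t = k * d" using multiple by blast
    then have "t = 2 * pi * k / m" by (simp add: dm)
    then show "x \<in> cyclic_Z m" unfolding cyclic_Z_def xt by blast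
  next
    fix x assume "x \<in> cyclic_Z m"
    then obtain k :: int where k: "x = quat_of_complex (cis (2 * pi * k / m))"
      unfolding cyclic_Z_def by blast
    have "2 * pi * k / m = k * d" by (simp add: dm)
    then have "x \<in> A" using H_int[OF dH, of k] by (simp add: H_def k)
    then show "x \<in> {x \<in> A. qJ x = 0 \<and> qK x = 0}" by (simp add: k)
  qed
  then show ?thesis using m by blast
qed

end

lemma minus_one_in_cyclic_Z:
  assumes "m \<ge> 1" "-1 \<in> cyclic_Z m"
  shows "even m"
proof -
  obtain k :: int where "-1 = quat_of_complex (cis (2 * pi * k / m))"
    using assms by (auto simp: cyclic_Z_def)
  then have "cos (2 * pi * k / m) = -1" by (simp add: quat_eq_iff)
  then have "cos (2 * pi * k / m - pi) = 1" by (simp add: cos_diff)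
  then obtain l :: int where "2 * pi * k / m - pi = real_of_int l * 2 * pi"
    unfolding cos_one_2pi_int by blast
  then have "2 * pi * k = (2 * l + 1) * pi * m" using assms(1) by (simp add: field_simps)
  then have "real_of_int (2 * k) = real_of_int ((2 * l + 1) * int m)"
    by simp
  then have "2 * k = (2 * l + 1) * int m" by linarith
  then have "even ((2 * l + 1) * int m)" by (metis dvd_triv_left)
  then show "even m" by simp
qed

context finite_unit_group
begin

text \<open>Conjugate \<open>x\<close> into the complex numbers, where the group is cyclic; it has even order because
it contains \<open>-1\<close>.\<close>

lemma qRe_eq_cos:
  assumes "-1 \<in> A" "x \<in> A"
  shows "\<exists>m::nat. m \<ge> (1::nat) \<and> (\<exists>k::int. qRe x = cos (pi * k / m) \<and> (\<exists>y\<in>A. qRe y = cos (pi / m)))"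
proof -
  obtain w where w: "w \<in> unit_quaternions" "qJ (qconj w x) = 0" "qK (qconj w x) = 0"
    using conj_imaginary_to_complex[OF is_unit[OF assms(2)]] by force
  interpret B: finite_unit_group "qconj w ` A" by (rule qconj_image[OF w(1)])
  \<comment> \<open>The angles in this cyclic group are the multiples of \<open>2\<pi>/M = \<pi>/m\<close>; \<open>y\<close> corresponds to the generator.\<close>
  obtain M where M: "M \<ge> 1" "{x \<in> qconj w ` A. qJ x = 0 \<and> qK x = 0} = cyclic_Z M"
    using B.complex_part_cyclic by blast
  have "qconj w (-1) = -1" using w(1) by (simp add: qconj_uminus)
  then have "-1 \<in> qconj w ` A" using assms(1) by (metis imageI)
  then have "-1 \<in> cyclic_Z M" unfolding M(2)[symmetric] by simp
  then obtain m where m: "M = 2 * m" using minus_one_in_cyclic_Z[OF M(1)] by (auto elim: evenE)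
  then have m1: "m \<ge> 1" using M(1) by simp
  have "qconj w x \<in> cyclic_Z M" unfolding M(2)[symmetric] using w assms by simp
  then obtain k :: int where "qconj w x = quat_of_complex (cis (2 * pi * k / M))"
    by (auto simp: cyclic_Z_def)
  then have "qRe (qconj w x) = cos (pi * k / m)" by (simp add: m)
  moreover
  have "quat_of_complex (cis (2 * pi * real_of_int 1 / M)) \<in> cyclic_Z M" unfolding cyclic_Z_def by blast
  then obtain y where "y \<in> A" "qconj w y = quat_of_complex (cis (2 * pi * real_of_int 1 / M))"
    unfolding M(2)[symmetric] by force
  then have "y \<in> A" "qRe (qconj w y) = cos (pi / m)" by (simp_all add: m)
  ultimately show ?thesis using m1 w(1) by auto
qed

end

section \<open>Cosines of rational multiples of \<open>\<pi>\<close>\<close>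

lemma golden_ratio_square: "golden_ratio * golden_ratio = golden_ratio + 1"
  by (simp add: golden_ratio_def field_simps)

lemma inverse_golden_ratio: "inverse golden_ratio = golden_ratio - 1"
proof (rule inverse_unique)
  show "golden_ratio * (golden_ratio - 1) = 1"
    using golden_ratio_square by (simp add: algebra_simps)
qed

lemma golden_ratio_bounds: "1618/1000 < golden_ratio" "golden_ratio < 16181/10000"
proof -
  have "2236/1000 < sqrt 5" by (rule real_less_rsqrt) (simp add: power2_eq_square)
  then show "1618/1000 < golden_ratio" by (simp add: golden_ratio_def)
  have "sqrt 5 < 22362/10000" by (rule real_less_lsqrt) (simp_all add: power2_eq_square)
  then show "golden_ratio < 16181/10000" by (simp add: golden_ratio_def)
qed

lemma sqrt_2_bounds: "1414/1000 < sqrt 2" "sqrt 2 < 14143/10000"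
proof -
  show "1414/1000 < sqrt 2" by (rule real_less_rsqrt) (simp add: power2_eq_square)
  show "sqrt 2 < 14143/10000" by (rule real_less_lsqrt) (simp_all add: power2_eq_square)
qed

text \<open>The Chebyshev polynomial of degree \<open>m\<close> takes the value \<open>\<plusminus>1\<close> at \<open>cos (k\<pi>/m)\<close>. For small \<open>m\<close> the
resulting equation factors into linear and quadratic terms.\<close>

lemma cos_rational_values:
  fixes k :: int
  shows "cos (pi * k) \<in> {1, -1}"
    and "cos (pi * k / 2) \<in> {0, 1, -1}"
    and "cos (pi * k / 3) \<in> {1, -1, 1/2, -1/2}"
    and "cos (pi * k / 4) \<in> {0, 1, -1, sqrt 2 / 2, - sqrt 2 / 2}"
    and "cos (pi * k / 5) \<in> {1, -1, golden_ratio / 2, - golden_ratio / 2,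
           (golden_ratio - 1) / 2, - (golden_ratio - 1) / 2}"
proof -
  have pm: "cos (pi * k) = 1 \<or> cos (pi * k) = -1" by (simp add: cos_npi_int)
  then show "cos (pi * k) \<in> {1, -1}" by simp
  have double: "cos (2 * t) = 2 * (cos t)\<^sup>2 - 1" for t :: real by (rule cos_double_cos)
  {
    define y where "y = cos (pi * k / 2)"
    have "cos (pi * k) = 2 * y\<^sup>2 - 1" unfolding y_def double[symmetric] by simp
    then have "y = 0 \<or> y\<^sup>2 = 1" using pm by auto
    then show "cos (pi * k / 2) \<in> {0, 1, -1}" by (auto simp: y_def power2_eq_1_iff)
  }
  {
    define y where "y = cos (pi * k / 3)"
    have "cos (pi * k) = cos (3 * (pi * k / 3))" by simp
    also have "\<dots> = 4 * y^3 - 3 * y" unfolding y_def by (rule cos_treble_cos)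
    finally have "(y - 1) * (2 * y + 1)\<^sup>2 = 0 \<or> (y + 1) * (2 * y - 1)\<^sup>2 = 0"
      using pm by (simp only: power2_eq_square power3_eq_cube) (auto simp: algebra_simps)
    then have "y = 1 \<or> 2 * y = -1 \<or> y = -1 \<or> 2 * y = 1" by auto
    then show "cos (pi * k / 3) \<in> {1, -1, 1/2, -1/2}" by (auto simp flip: y_def)
  }
  {
    define y where "y = cos (pi * k / 4)"
    have "cos (pi * k) = cos (2 * (2 * (pi * k / 4)))" by simp
    also have "\<dots> = 2 * (2 * y\<^sup>2 - 1)\<^sup>2 - 1" unfolding y_def double ..
    finally have "y\<^sup>2 * (y\<^sup>2 - 1) = 0 \<or> (2 * y\<^sup>2 - 1)\<^sup>2 = 0"
      using pm by (simp only: power2_eq_square) (auto simp: algebra_simps)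
    moreover have "2 * y\<^sup>2 - 1 = 2 * (y - sqrt 2 / 2) * (y + sqrt 2 / 2)"
      by (simp add: power2_eq_square algebra_simps)
    ultimately have "y = 0 \<or> y\<^sup>2 = 1 \<or> y = sqrt 2 / 2 \<or> y = - (sqrt 2 / 2)"
      by (auto simp: eq_neg_iff_add_eq_0)
    then show "cos (pi * k / 4) \<in> {0, 1, -1, sqrt 2 / 2, - sqrt 2 / 2}"
      by (auto simp: power2_eq_1_iff simp flip: y_def)
  }
  {
    define y where "y = cos (pi * k / 5)"
    let ?t = "pi * k / 5"
    have "cos (pi * k) = 2 * (cos (3 * ?t) * cos (2 * ?t)) - cos ?t"
      unfolding cos_times_cos by (simp add: field_simps)
    also have "\<dots> = 2 * ((4 * y^3 - 3 * y) * (2 * y\<^sup>2 - 1)) - y"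
      unfolding y_def double cos_treble_cos ..
    finally have "(y - 1) * (4 * y\<^sup>2 + 2 * y - 1)\<^sup>2 = 0 \<or> (y + 1) * (4 * y\<^sup>2 - 2 * y - 1)\<^sup>2 = 0"
      using pm by (simp only: power2_eq_square power3_eq_cube) (auto simp: algebra_simps)
    then have "y - 1 = 0 \<or> y + 1 = 0 \<or> 4 * y\<^sup>2 + 2 * y - 1 = 0 \<or> 4 * y\<^sup>2 - 2 * y - 1 = 0"
      by auto
    moreover have "4 * y\<^sup>2 + 2 * y - 1 = 4 * ((y - (golden_ratio - 1) / 2) * (y + golden_ratio / 2))"
      "4 * y\<^sup>2 - 2 * y - 1 = 4 * ((y + (golden_ratio - 1) / 2) * (y - golden_ratio / 2))"
      using golden_ratio_square by (simp_all add: power2_eq_square field_simps)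
    ultimately have "y - 1 = 0 \<or> y + 1 = 0 \<or>
        (y - (golden_ratio - 1) / 2 = 0 \<or> y + golden_ratio / 2 = 0) \<or>
        (y + (golden_ratio - 1) / 2 = 0 \<or> y - golden_ratio / 2 = 0)"
      by (simp only: mult_eq_0_iff zero_neq_numeral[symmetric] simp_thms)
    then have "y = 1 \<or> y = (golden_ratio - 1) / 2 \<or> y = - (golden_ratio / 2) \<or>
      y = -1 \<or> y = - ((golden_ratio - 1) / 2) \<or> y = golden_ratio / 2"
      by linarith
    then show "cos (pi * k / 5) \<in> {1, -1, golden_ratio / 2, - golden_ratio / 2,
           (golden_ratio - 1) / 2, - (golden_ratio - 1) / 2}"
      unfolding y_def[symmetric] insert_iff by linarith
  }
qed

lemma cos_pi_fifth: "cos (pi / 5) = golden_ratio / 2"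
proof -
  have "cos (pi / 3) < cos (pi / 5)" "cos (pi / 5) < cos 0"
    by (intro cos_monotone_0_pi; simp add: field_simps)+
  then have "1/2 < cos (pi / 5)" "cos (pi / 5) < 1" by (simp_all add: cos_60)
  moreover have "cos (pi / 5) \<in> {1, -1, golden_ratio / 2, - golden_ratio / 2,
           (golden_ratio - 1) / 2, - (golden_ratio - 1) / 2}"
    using cos_rational_values(5)[of 1] by simp
  ultimately show ?thesis using golden_ratio_bounds by auto
qed

text \<open>Reduce \<open>k\<close> modulo \<open>2m\<close> and use the symmetry of the cosine about \<open>\<pi>\<close>.\<close>

lemma cos_le_cos_pi_div:
  fixes k :: int and m :: nat
  assumes m: "m \<ge> 1" and "cos (pi * k / m) \<noteq> 1"
  shows "cos (pi * k / m) \<le> cos (pi / m)"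
proof -
  have le: "cos (pi * real_of_int j / m) \<le> cos (pi / m)" if "1 \<le> j" "j \<le> int m" for j
    by (rule cos_monotone_0_pi_le) (use that m in \<open>auto simp: field_simps\<close>)
  define j where "j = k mod (2 * int m)"
  define q where "q = k div (2 * int m)"
  have k: "k = j + 2 * int m * q" by (simp add: j_def q_def)
  have j: "0 \<le> j" "j < 2 * int m" using m by (simp_all add: j_def)
  have "pi * k / m = pi * j / m + 2 * pi * q" using m by (simp add: k field_simps)
  then have cj: "cos (pi * k / m) = cos (pi * j / m)" by (metis sin_cos_eq_iff)
  have "j \<noteq> 0" using assms(2) unfolding cj by auto
  show ?thesis
  proof (cases "j \<le> int m")
    case True
    then show ?thesis unfolding cj using le j \<open>j \<noteq> 0\<close> by simp
  next
    case False
    have "cos (pi * j / m) = cos (pi * real_of_int (2 * int m - j) / m)"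
    proof -
      have "pi * real_of_int (2 * int m - j) / m = 2 * pi - pi * j / m"
        using m by (simp add: field_simps)
      then show ?thesis by simp
    qed
    then show ?thesis unfolding cj using le[of "2 * int m - j"] j False by simp
  qed
qed

lemma cos_pi_div_less_1:
  fixes m :: nat
  assumes "m \<ge> 1"
  shows "cos (pi / m) < 1"
  using cos_monotone_0_pi[of 0 "pi / m"] assms by (simp add: field_simps)

lemma cos_pi_div_le_iff:
  fixes m n :: nat
  assumes "m \<ge> 1" "n \<ge> 1"
  shows "cos (pi / m) \<le> cos (pi / n) \<longleftrightarrow> m \<le> n"
  using assms by (subst cos_mono_le_eq) (auto simp: field_simps)

section \<open>Real parts in a finite group\<close>

context finite_unit_group
begin

lemma exists_max_qRe:
  assumes "-1 \<in> A"
  shows "\<exists>n::nat. n \<ge> (1::nat) \<and> (\<exists>g\<in>A. qRe g = cos (pi / n)) \<and> (\<forall>x\<in>A. x \<noteq> 1 \<longrightarrow> qRe x \<le> cos (pi / n))"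
proof -
  have "A - {1} \<noteq> {}" using assms by (auto simp: quat_eq_iff)
  then have "Max (qRe ` (A - {1})) \<in> qRe ` (A - {1})"
    using finite by (intro Max_in) auto
  then obtain g where "g \<in> A - {1}" "qRe g = Max (qRe ` (A - {1}))" by force
  then have g: "g \<in> A" "g \<noteq> 1" "\<And>x. x \<in> A \<Longrightarrow> x \<noteq> 1 \<Longrightarrow> qRe x \<le> qRe g"
    using finite by auto
  obtain m :: nat and k :: int and y where
    m: "m \<ge> 1" "qRe g = cos (pi * k / m)" "y \<in> A" "qRe y = cos (pi / m)"
    using qRe_eq_cos[OF assms g(1)] by blast
  have "qRe g \<noteq> 1" using unit_qRe_eq_1 is_unit g by blast
  then have "qRe g \<le> cos (pi / m)" using cos_le_cos_pi_div m by simp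
  moreover have "y \<noteq> 1" using cos_pi_div_less_1[OF m(1)] m(4) by auto
  ultimately have "qRe g = cos (pi / m)" using g m by force
  then show ?thesis using g m by metis
qed

lemma qRe_cases:
  fixes n :: nat
  assumes "-1 \<in> A" "n \<ge> 1" and max: "\<forall>y\<in>A. y \<noteq> 1 \<longrightarrow> qRe y \<le> cos (pi / n)"
    and "x \<in> A"
  obtains m :: nat and k :: int where "1 \<le> m" "m \<le> n" "qRe x = cos (pi * k / m)"
proof -
  obtain m :: nat and k :: int and y where
    m: "m \<ge> 1" "qRe x = cos (pi * k / m)" "y \<in> A" "qRe y = cos (pi / m)"
    using qRe_eq_cos[OF assms(1,4)] by blast
  have "y \<noteq> 1" using cos_pi_div_less_1[OF m(1)] m(4) by auto
  then have "m \<le> n" using max m assms(2) cos_pi_div_le_iff by metis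
  then show ?thesis using that m by blast
qed

lemma qRe_values:
  fixes n :: nat
  assumes "-1 \<in> A" and max: "\<forall>y\<in>A. y \<noteq> 1 \<longrightarrow> qRe y \<le> cos (pi / n)"
    and x: "x \<in> A"
  shows "n = 1 \<Longrightarrow> qRe x \<in> {1, -1}"
    and "n = 2 \<Longrightarrow> qRe x \<in> {0, 1, -1}"
    and "n = 3 \<Longrightarrow> qRe x \<in> {0, 1, -1, 1/2, -1/2}"
    and "n = 4 \<Longrightarrow> qRe x \<in> {0, 1, -1, 1/2, -1/2, sqrt 2 / 2, - sqrt 2 / 2}"
    and "n = 5 \<Longrightarrow> qRe x \<in> {0, 1, -1, 1/2, -1/2, sqrt 2 / 2, - sqrt 2 / 2,
      golden_ratio / 2, - golden_ratio / 2, (golden_ratio - 1) / 2, - (golden_ratio - 1) / 2}"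
proof -
  have *: "(n \<ge> 1 \<and> qRe x \<in> {1, -1}) \<or> (n \<ge> 2 \<and> qRe x \<in> {0, 1, -1}) \<or>
    (n \<ge> 3 \<and> qRe x \<in> {1, -1, 1/2, -1/2}) \<or>
    (n \<ge> 4 \<and> qRe x \<in> {0, 1, -1, sqrt 2 / 2, - sqrt 2 / 2}) \<or>
    (n \<ge> 5 \<and> qRe x \<in> {1, -1, golden_ratio / 2, - golden_ratio / 2,
           (golden_ratio - 1) / 2, - (golden_ratio - 1) / 2})" if n: "1 \<le> n" "n \<le> 5"
  proof -
    obtain m :: nat and k :: int where m: "1 \<le> m" "m \<le> n" "qRe x = cos (pi * k / m)"
      using qRe_cases[OF assms(1) n(1) max x] by blast
    then have "m = 1 \<or> m = 2 \<or> m = 3 \<or> m = 4 \<or> m = 5" using n by linarith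
    then show ?thesis
      using m cos_rational_values[of k] by (elim disjE) (simp_all del: insert_iff)
  qed
  show "n = 1 \<Longrightarrow> qRe x \<in> {1, -1}" using * by auto
  show "n = 2 \<Longrightarrow> qRe x \<in> {0, 1, -1}" using * by auto
  show "n = 3 \<Longrightarrow> qRe x \<in> {0, 1, -1, 1/2, -1/2}" using * by auto
  show "n = 4 \<Longrightarrow> qRe x \<in> {0, 1, -1, 1/2, -1/2, sqrt 2 / 2, - sqrt 2 / 2}" using * by auto
  show "n = 5 \<Longrightarrow> qRe x \<in> {0, 1, -1, 1/2, -1/2, sqrt 2 / 2, - sqrt 2 / 2,
      golden_ratio / 2, - golden_ratio / 2, (golden_ratio - 1) / 2, - (golden_ratio - 1) / 2}"
    using * by auto
qed

end

section \<open>Cyclic and binary dihedral groups\<close>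

lemma two_D_eq: "two_D m = cyclic_Z (2 * m) \<union> (\<lambda>x. quat_j * x) ` cyclic_Z (2 * m)"
proof -
  have "2 * pi * real_of_int x / real (2 * m) = pi * real_of_int x / real m" for x by simp
  then show ?thesis unfolding two_D_def cyclic_Z_def by auto
qed

text \<open>With the axis of \<open>g\<close> equal to \<open>i\<close>, an element commuting with \<open>g\<close> is complex, and one inverting
\<open>g\<close> lies in the plane of \<open>j\<close> and \<open>k\<close>; the latter form one coset of the former, represented by
\<open>j\<close>.\<close>

lemma (in finite_unit_group) cyclic_or_two_D_aligned:
  assumes minus: "-1 \<in> A" and g: "g \<in> A" "qI g \<noteq> 0" "qJ g = 0" "qK g = 0"
    and comm: "\<And>h. h \<in> A \<Longrightarrow> qconj h g \<in> {g, qcnj g}"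
    and j: "quat_j \<in> A \<or> (\<forall>h\<in>A. qconj h g = g)"
  shows "(\<exists>n\<ge>2. A = cyclic_Z n) \<or> (\<exists>n\<ge>2. A = two_D n)"
proof -
  have com: "qJ h = 0 \<and> qK h = 0" if "h \<in> A" "qconj h g = g" for h
  proof -
    have "h * g = qconj h g * h" using is_unit[OF that(1)] by (simp add: qconj_def mult.assoc)
    then have "h * g = g * h" using that by simp
    then show ?thesis using g by (auto simp: quat_eq_iff)
  qed
  have anti: "qRe h = 0 \<and> qI h = 0" if "h \<in> A" "qconj h g = qcnj g" for h
  proof -
    have "h * g = qconj h g * h" using is_unit[OF that(1)] by (simp add: qconj_def mult.assoc)
    then have "h * g = qcnj g * h" using that by simp
    then show ?thesis using g by (auto simp: quat_eq_iff)
  qed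
  obtain M where M: "M \<ge> 1" "{x \<in> A. qJ x = 0 \<and> qK x = 0} = cyclic_Z M"
    using complex_part_cyclic by blast
  have "-1 \<in> cyclic_Z M" unfolding M(2)[symmetric] using minus by simp
  then obtain m where m: "M = 2 * m" using minus_one_in_cyclic_Z[OF M(1)] by (auto elim: evenE)
  have "g \<in> cyclic_Z M" unfolding M(2)[symmetric] using g by simp
  then obtain k :: int where k: "g = quat_of_complex (cis (2 * pi * k / M))"
    unfolding cyclic_Z_def by blast
  \<comment> \<open>Otherwise the complex part is \<open>{1, -1}\<close>, which does not contain \<open>g\<close>.\<close>
  have "m \<noteq> 1"
  proof
    assume "m = 1"
    then have "qI g = sin (pi * k)" by (simp add: k m)
    then show False using g(2) by (simp add: sin_npi_int)
  qed
  then have m2: "m \<ge> 2" using M(1) m by simp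
  show ?thesis
  proof (cases "\<forall>h\<in>A. qconj h g = g")
    case True
    then have "{x \<in> A. qJ x = 0 \<and> qK x = 0} = A" using com by blast
    then show ?thesis using M m2 m by (metis le_trans mult_le_mono1 one_le_numeral mult_1)
  next
    case False
    then have jA: "quat_j \<in> A" using j by blast
    have "A = two_D m"
    proof (rule Set.set_eqI, rule iffI)
      fix x assume x: "x \<in> A"
      show "x \<in> two_D m"
      proof (cases "qconj x g = g")
        case True
        then show ?thesis using com[OF x True] x M(2) unfolding two_D_eq m by blast
      next
        case False
        then have "qRe x = 0 \<and> qI x = 0" using anti comm x by blast
        then have "qcnj quat_j * x \<in> {x \<in> A. qJ x = 0 \<and> qK x = 0}"
          using mult[OF qcnj[OF jA] x] by simp
        moreover have "x = quat_j * (qcnj quat_j * x)"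
          using is_unit[OF jA] by simp
        ultimately show ?thesis using M(2) unfolding two_D_eq m by blast
      qed
    next
      fix x assume "x \<in> two_D m"
      then show "x \<in> A" unfolding two_D_eq m[symmetric] M(2)[symmetric] using mult jA by auto
    qed
    then show ?thesis using m2 by blast
  qed
qed

lemma (in finite_unit_group) cyclic_or_two_D:
  assumes minus: "-1 \<in> A" and g: "g \<in> A" "(qRe g)\<^sup>2 \<noteq> 1"
    and comm: "\<And>h. h \<in> A \<Longrightarrow> qconj h g \<in> {g, qcnj g}"
  shows "\<exists>w\<in>unit_quaternions. (\<exists>n\<ge>2. qconj w ` A = cyclic_Z n) \<or> (\<exists>n\<ge>2. qconj w ` A = two_D n)"
proof -
  have "\<exists>w\<in>unit_quaternions. qconj w g = Quat (qRe g) (sqrt (1 - (qRe g)\<^sup>2)) 0 0 \<and>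
    (quat_j \<in> qconj w ` A \<or> (\<forall>h\<in>A. qconj h g = g))"
  proof (cases "\<forall>h\<in>A. qconj h g = g")
    case True
    then show ?thesis using conj_imaginary_to_complex[OF is_unit[OF g(1)]] by blast
  next
    case False
    then obtain h where h: "h \<in> A" "qconj h g = qcnj g" using comm by blast
    obtain w x y where w: "w \<in> unit_quaternions" "0 \<le> y"
      "qconj w g = Quat (qRe g) (sqrt (1 - (qRe g)\<^sup>2)) 0 0" "qconj w h = Quat (qRe h) x y 0"
      using conj_pair_normal_form[OF is_unit[OF g(1)] is_unit[OF h(1)]] by blast
    have "h * g = qconj h g * h" using is_unit[OF h(1)] by (simp add: qconj_def mult.assoc)
    then have "h * g = qcnj g * h" using h by simp
    then have "qconj w h * qconj w g = qcnj (qconj w g) * qconj w h"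
      using w(1) by (simp flip: qconj_mult qconj_qcnj)
    then have "qRe h = 0" "x = 0" using g(2) by (auto simp: w quat_eq_iff)
    moreover have "qconj w h \<in> unit_quaternions" using unit_qconj w(1) is_unit h(1) by blast
    ultimately have "y\<^sup>2 = 1" by (simp add: w unit_iff)
    then have "y = 1" using w(2) by (simp add: power2_eq_1_iff)
    then have "qconj w h = quat_j" by (simp add: w quat_eq_iff \<open>qRe h = 0\<close> \<open>x = 0\<close>)
    then show ?thesis using w h by (metis imageI)
  qed
  then obtain w where w: "w \<in> unit_quaternions"
    "qconj w g = Quat (qRe g) (sqrt (1 - (qRe g)\<^sup>2)) 0 0"
    "quat_j \<in> qconj w ` A \<or> (\<forall>h\<in>A. qconj h g = g)" by blast
  interpret B: finite_unit_group "qconj w ` A" by (rule qconj_image[OF w(1)])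
  have conj: "qconj (qconj w h) (qconj w g) = qconj w (qconj h g)" for h
    using w(1) by (simp add: qconj_mult qconj_qcnj qconj_def[of h] qconj_def[of "qconj w h"])
  have "(\<exists>n\<ge>2. qconj w ` A = cyclic_Z n) \<or> (\<exists>n\<ge>2. qconj w ` A = two_D n)"
  proof (rule B.cyclic_or_two_D_aligned[of "qconj w g"])
    have "qconj w (-1) = -1" using w(1) by (simp add: qconj_uminus)
    then show "-1 \<in> qconj w ` A" using minus by (metis imageI)
    show "qconj w g \<in> qconj w ` A" using g by simp
    show "qI (qconj w g) \<noteq> 0" "qJ (qconj w g) = 0" "qK (qconj w g) = 0"
      using g(2) by (simp_all add: w)
    show "qconj h (qconj w g) \<in> {qconj w g, qcnj (qconj w g)}" if "h \<in> qconj w ` A" for h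
      using that comm by (fastforce simp: conj simp flip: qconj_qcnj)
    show "quat_j \<in> qconj w ` A \<or> (\<forall>h\<in>qconj w ` A. qconj h (qconj w g) = qconj w g)"
      using w(3) by (auto simp: conj)
  qed
  then show ?thesis using w(1) by blast
qed

section \<open>Rotations about different axes\<close>

definition qdot :: "quat \<Rightarrow> quat \<Rightarrow> real" where
  "qdot p q = qI p * qI q + qJ p * qJ q + qK p * qK q"

lemma qRe_mult_qdot: "qRe (p * q) = qRe p * qRe q - qdot p q"
  "qRe (p * qcnj q) = qRe p * qRe q + qdot p q"
  by (simp_all add: qdot_def)

lemma qdot_qcnj: "qdot p (qcnj q) = - qdot p q"
  by (simp add: qdot_def)

text \<open>The strict Cauchy-Schwarz inequality for the imaginary parts.\<close>

lemma abs_qdot_less: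
  assumes "g \<in> unit_quaternions" "h \<in> unit_quaternions" "qRe h = qRe g" "h \<noteq> g" "h \<noteq> qcnj g"
  shows "\<bar>qdot g h\<bar> < 1 - (qRe g)\<^sup>2"
proof -
  have n: "(qI g)\<^sup>2 + (qJ g)\<^sup>2 + (qK g)\<^sup>2 = 1 - (qRe g)\<^sup>2"
    "(qI h)\<^sup>2 + (qJ h)\<^sup>2 + (qK h)\<^sup>2 = 1 - (qRe g)\<^sup>2"
    using assms by (simp_all add: unit_iff)
  have pos: "0 < x\<^sup>2 + y\<^sup>2 + z\<^sup>2" if "x \<noteq> 0 \<or> y \<noteq> 0 \<or> z \<noteq> 0" for x y z :: real
    using that zero_le_power2[of x] zero_le_power2[of y] zero_le_power2[of z]
    by (smt (verit) zero_less_power2)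
  have "0 < (qI g - qI h)\<^sup>2 + (qJ g - qJ h)\<^sup>2 + (qK g - qK h)\<^sup>2"
    using assms(3,4) by (intro pos) (auto simp: quat_eq_iff)
  moreover have "0 < (qI g + qI h)\<^sup>2 + (qJ g + qJ h)\<^sup>2 + (qK g + qK h)\<^sup>2"
    using assms(3,5) by (intro pos) (auto simp: quat_eq_iff)
  ultimately show ?thesis
    using n unfolding qdot_def abs_less_iff power2_sum power2_diff by linarith
qed

lemma qRe_commutator:
  assumes "g \<in> unit_quaternions" "h \<in> unit_quaternions" "qRe h = qRe g"
  shows "qRe (g * h * qcnj g * qcnj h) = 1 - 2 * ((1 - (qRe g)\<^sup>2)\<^sup>2 - (qdot g h)\<^sup>2)"
proof -
  have "(qRe g)\<^sup>2 + (qI g)\<^sup>2 + (qJ g)\<^sup>2 + (qK g)\<^sup>2 = 1"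
    "(qRe g)\<^sup>2 + (qI h)\<^sup>2 + (qJ h)\<^sup>2 + (qK h)\<^sup>2 = 1"
    using assms by (simp_all add: unit_iff)
  then show ?thesis
    unfolding qdot_def by (simp add: assms(3)) algebra
qed

text \<open>Among the pairs \<open>p, q\<close> of rotations by the same angle with different axes, choose one with the
largest inner product. Rotating the axis of \<open>q\<close> about that of \<open>p\<close> gives a pair \<open>r, q\<close>, which
is no closer, and the formula for the real part of the commutator \<open>r q\<^sup>-\<^sup>1\<close> turns this into an
inequality that contradicts \<open>1 - c\<^sup>2 \<le> 1/4\<close>.\<close>

lemma (in finite_unit_group) unique_axis_of_small_rotation:
  assumes c: "0 < c" "3 / 4 \<le> c\<^sup>2" "c < 1"
    and g: "g \<in> A" "qRe g = c" and h: "h \<in> A" "qRe h = c"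
  shows "h \<in> {g, qcnj g}"
proof (rule ccontr)
  define P where "P = {(p, q) \<in> A \<times> A. qRe p = c \<and> qRe q = c \<and> q \<noteq> p \<and> q \<noteq> qcnj p}"
  assume "h \<notin> {g, qcnj g}"
  then have "(g, h) \<in> P" using g h by (simp add: P_def)
  moreover have "finite P"
    by (rule finite_subset[of _ "A \<times> A"]) (auto simp: P_def finite)
  ultimately have "Max ((\<lambda>(p, q). qdot p q) ` P) \<in> (\<lambda>(p, q). qdot p q) ` P"
    by (intro Max_in) auto
  then obtain p q where pq: "(p, q) \<in> P" "qdot p q = Max ((\<lambda>(p, q). qdot p q) ` P)" by force
  have max: "qdot p' q' \<le> qdot p q" if "(p', q') \<in> P" for p' q'
    unfolding pq(2) using \<open>finite P\<close> that by (intro Max_ge) force+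
  have p: "p \<in> A" "qRe p = c" and q: "q \<in> A" "qRe q = c" and ne: "q \<noteq> p" "q \<noteq> qcnj p"
    using pq(1) by (auto simp: P_def)
  note pu = is_unit[OF p(1)] and qu = is_unit[OF q(1)]
  define s where "s = 1 - c\<^sup>2"
  have s: "0 < s" "s \<le> 1 / 4" using c by (simp_all add: s_def abs_square_less_1)
  define D where "D = qdot p q"
  have D: "\<bar>D\<bar> < s" using abs_qdot_less[OF pu qu _ ne] p q by (simp add: s_def D_def)
  define r where "r = qconj p q"
  have r: "r \<in> A" "qRe r = c"
    using conjugation_closed p q pu by (simp_all add: r_def)
  have "qRe (r * qcnj q) = 1 - 2 * (s\<^sup>2 - D\<^sup>2)"
    using qRe_commutator[OF pu qu] p q by (simp add: r_def qconj_def s_def D_def del: quat_sel)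
  then have rq: "c\<^sup>2 + qdot r q = 1 - 2 * (s\<^sup>2 - D\<^sup>2)"
    unfolding qRe_mult_qdot(2) r q by (simp add: power2_eq_square)
  have "D\<^sup>2 < s\<^sup>2" using D by (metis abs_of_nonneg abs_le_square_iff linorder_not_less order_less_imp_le s(1))
  have "s\<^sup>2 \<le> s * (1/4)" using s unfolding power2_eq_square by (intro mult_left_mono) simp_all
  have "q \<noteq> r"
  proof
    assume "q = r"
    then have "qdot r q = s" using qu q
      by (simp add: s_def qdot_def unit_iff power2_eq_square algebra_simps)
    then show False using rq \<open>D\<^sup>2 < s\<^sup>2\<close> by (simp add: s_def)
  qed
  moreover have "q \<noteq> qcnj r"
  proof
    assume "q = qcnj r"
    then have "r = qcnj q" by simp
    then have "qdot r q = - s" using qu q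
      by (simp add: s_def qdot_def unit_iff power2_eq_square algebra_simps)
    then have "1 - s - s = 1 - 2 * (s\<^sup>2 - D\<^sup>2)" using rq by (simp add: s_def)
    then have "s = s\<^sup>2 - D\<^sup>2" by simp
    moreover have "0 \<le> D\<^sup>2" by simp
    ultimately show False using s(1) \<open>s\<^sup>2 \<le> s * (1/4)\<close> by simp
  qed
  ultimately have "(r, q) \<in> P" using r q by (simp add: P_def)
  then have "qdot r q \<le> D" using max by (simp add: D_def)
  then have "s - D \<le> 2 * (s\<^sup>2 - D\<^sup>2)" using rq by (simp add: s_def)
  also have "\<dots> = (s - D) * (2 * (s + D))" by (simp add: power2_eq_square algebra_simps)
  finally have "(s - D) * 1 \<le> (s - D) * (2 * (s + D))" by simp
  \<comment> \<open>Cancel the factor \<open>s - D > 0\<close>.\<close>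
  then have "1 \<le> 2 * s + 2 * D" using D by (subst (asm) mult_le_cancel_left_pos) auto
  then show False using D s by linarith
qed

section \<open>The binary tetrahedral group\<close>

lemma cyclic_Z_4: "cyclic_Z 4 = {1, -1, Quat 0 1 0 0, Quat 0 (-1) 0 0}"
proof -
  have val: "quat_of_complex (cis (2 * pi * real_of_int x / real 4)) =
    (if x mod 4 = 0 then 1 else if x mod 4 = 1 then Quat 0 1 0 0 else
     if x mod 4 = 2 then -1 else Quat 0 (-1) 0 0)" for x :: int
  proof -
    define q r where "q = x div 4" and "r = x mod 4"
    have x: "x = 4 * q + r" and "r = 0 \<or> r = 1 \<or> r = 2 \<or> r = 3" by (auto simp: q_def r_def)
    have *: "2 * pi * real_of_int x / real 4 = pi * r / 2 + 2 * pi * q"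
      by (simp add: x field_simps)
    have "cis (2 * pi * real_of_int x / real 4) = cis (pi * r / 2)"
      unfolding * by (simp flip: cis_mult)
    moreover have "cos (pi * 3 / 2) = 0" "sin (pi * 3 / 2) = -1"
      using cos_3over2_pi sin_3over2_pi by (simp_all add: mult.commute)
    ultimately show ?thesis
      using \<open>r = 0 \<or> r = 1 \<or> r = 2 \<or> r = 3\<close>
      by (elim disjE) (simp_all add: quat_eq_iff flip: r_def)
  qed
  show ?thesis
  proof
    show "cyclic_Z 4 \<subseteq> {1, -1, Quat 0 1 0 0, Quat 0 (-1) 0 0}"
      unfolding cyclic_Z_def by (auto simp only: val split: if_splits)
    have "quat_of_complex (cis (2 * pi * real_of_int x / real 4)) \<in> cyclic_Z 4" for x
      unfolding cyclic_Z_def by blast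
    from this[of 0] this[of 1] this[of 2] this[of 3]
    show "{1, -1, Quat 0 1 0 0, Quat 0 (-1) 0 0} \<subseteq> cyclic_Z 4"
      by (simp_all only: val) simp
  qed
qed

definition quat_basis :: "quat set" where
  "quat_basis = {1, -1, Quat 0 1 0 0, Quat 0 (-1) 0 0, Quat 0 0 1 0, Quat 0 0 (-1) 0,
    Quat 0 0 0 1, Quat 0 0 0 (-1)}"

lemma two_D_2: "two_D 2 = quat_basis"
proof -
  have "quat_j * 1 = Quat 0 0 1 0" "quat_j * -1 = Quat 0 0 (-1) 0"
    "quat_j * Quat 0 1 0 0 = Quat 0 0 0 (-1)" "quat_j * Quat 0 (-1) 0 0 = Quat 0 0 0 1"
    by (simp_all add: quat_eq_iff)
  then show ?thesis
    unfolding two_D_eq quat_basis_def by (simp add: cyclic_Z_4 insert_commute)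
qed

lemma two_T_iff:
  "x \<in> two_T \<longleftrightarrow> x \<in> quat_basis \<or> {qRe x, qI x, qJ x, qK x} \<subseteq> {1/2, -1/2}"
  unfolding two_T_def two_D_2 by (auto simp: quat_eq_iff)

text \<open>These are the units of the Hurwitz order; in this form closure under multiplication is easy to
check.\<close>

lemma two_T_iff_coordinates:
  "x \<in> two_T \<longleftrightarrow> x \<in> unit_quaternions \<and>
    {qRe x, qI x, qJ x, qK x} \<subseteq> {0, 1, -1, 1/2, -1/2}"
proof
  assume "x \<in> two_T"
  then consider "x \<in> quat_basis" | "{qRe x, qI x, qJ x, qK x} \<subseteq> {1/2, -1/2}"
    using two_T_iff by blast
  then show "x \<in> unit_quaternions \<and> {qRe x, qI x, qJ x, qK x} \<subseteq> {0, 1, -1, 1/2, -1/2}"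
  proof cases
    case 1
    then show ?thesis unfolding quat_basis_def by (auto simp: unit_iff)
  next
    case 2
    have sq: "a\<^sup>2 = 1/4" if "a \<in> {1/2, -1/2}" for a :: real
      using that by (auto simp only: insert_iff empty_iff) (simp_all add: power2_eq_square)
    have "(qRe x)\<^sup>2 = 1/4" "(qI x)\<^sup>2 = 1/4" "(qJ x)\<^sup>2 = 1/4" "(qK x)\<^sup>2 = 1/4"
      using 2 unfolding insert_subset by (iprover intro: sq)+
    then have "x \<in> unit_quaternions" by (simp add: unit_iff)
    moreover have "{qRe x, qI x, qJ x, qK x} \<subseteq> {0, 1, -1, 1/2, -1/2}"
      by (rule subset_trans[OF 2]) simp
    ultimately show ?thesis by (rule conjI)
  qed
next
  assume x: "x \<in> unit_quaternions \<and> {qRe x, qI x, qJ x, qK x} \<subseteq> {0, 1, -1, 1/2, -1/2}"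
  then have sqsum: "(qRe x)\<^sup>2 + (qI x)\<^sup>2 + (qJ x)\<^sup>2 + (qK x)\<^sup>2 = 1" by (simp add: unit_iff)
  show "x \<in> two_T"
  proof (cases "{qRe x, qI x, qJ x, qK x} \<subseteq> {0, 1/2, -1/2}")
    case True
    have sq: "a\<^sup>2 = 0 \<or> a\<^sup>2 = 1/4" if "a \<in> {0, 1/2, -1/2}" for a :: real
      using that by (auto simp only: insert_iff empty_iff) (simp_all add: power2_eq_square)
    have "(qRe x)\<^sup>2 = 0 \<or> (qRe x)\<^sup>2 = 1/4" "(qI x)\<^sup>2 = 0 \<or> (qI x)\<^sup>2 = 1/4"
      "(qJ x)\<^sup>2 = 0 \<or> (qJ x)\<^sup>2 = 1/4" "(qK x)\<^sup>2 = 0 \<or> (qK x)\<^sup>2 = 1/4"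
      using True unfolding insert_subset by (iprover intro: sq)+
    then have "(qRe x)\<^sup>2 = 1/4" "(qI x)\<^sup>2 = 1/4" "(qJ x)\<^sup>2 = 1/4" "(qK x)\<^sup>2 = 1/4"
      using sqsum by linarith+
    then have "qRe x \<noteq> 0" "qI x \<noteq> 0" "qJ x \<noteq> 0" "qK x \<noteq> 0" by auto
    then have "{qRe x, qI x, qJ x, qK x} \<subseteq> {1/2, -1/2}"
      using True unfolding insert_subset by simp
    then show ?thesis unfolding two_T_iff by blast
  next
    case False
    then obtain a where a: "a \<in> {qRe x, qI x, qJ x, qK x}" "a \<notin> {0, 1/2, -1/2}" by blast
    have "a \<in> {0, 1, -1, 1/2, -1/2}" using x a(1) by (meson subsetD)
    then have "a\<^sup>2 = 1" using a(2) unfolding insert_iff empty_iff by auto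
    then have one: "(qRe x)\<^sup>2 = 1 \<or> (qI x)\<^sup>2 = 1 \<or> (qJ x)\<^sup>2 = 1 \<or> (qK x)\<^sup>2 = 1"
      using a(1) by auto
    have zero: "p = 0 \<and> q = 0 \<and> r = 0" if "p\<^sup>2 + q\<^sup>2 + r\<^sup>2 = 0" for p q r :: real
      using that by (simp add: add_nonneg_eq_0_iff)
    have "x \<in> quat_basis"
      using one
    proof (elim disjE)
      assume h: "(qRe x)\<^sup>2 = 1"
      have "qI x = 0 \<and> qJ x = 0 \<and> qK x = 0"
        by (rule zero) (use h sqsum in linarith)
      moreover have "qRe x = 1 \<or> qRe x = -1" using h by (simp add: power2_eq_1_iff)
      ultimately show ?thesis by (elim disjE) (simp_all add: quat_basis_def quat_eq_iff)
    next
      assume h: "(qI x)\<^sup>2 = 1"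
      have "qRe x = 0 \<and> qJ x = 0 \<and> qK x = 0"
        by (rule zero) (use h sqsum in linarith)
      moreover have "qI x = 1 \<or> qI x = -1" using h by (simp add: power2_eq_1_iff)
      ultimately show ?thesis by (elim disjE) (simp_all add: quat_basis_def quat_eq_iff)
    next
      assume h: "(qJ x)\<^sup>2 = 1"
      have "qRe x = 0 \<and> qI x = 0 \<and> qK x = 0"
        by (rule zero) (use h sqsum in linarith)
      moreover have "qJ x = 1 \<or> qJ x = -1" using h by (simp add: power2_eq_1_iff)
      ultimately show ?thesis by (elim disjE) (simp_all add: quat_basis_def quat_eq_iff)
    next
      assume h: "(qK x)\<^sup>2 = 1"
      have "qRe x = 0 \<and> qI x = 0 \<and> qJ x = 0"
        by (rule zero) (use h sqsum in linarith)
      moreover have "qK x = 1 \<or> qK x = -1" using h by (simp add: power2_eq_1_iff)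
      ultimately show ?thesis by (elim disjE) (simp_all add: quat_basis_def quat_eq_iff)
    qed
    then show ?thesis using two_T_iff by blast
  qed
qed

lemma two_T_subset_unit: "two_T \<subseteq> unit_quaternions"
  using two_T_iff_coordinates by blast

lemma two_T_qcnj:
  assumes "x \<in> two_T"
  shows "qcnj x \<in> two_T"
proof -
  have "- a \<in> {0, 1, -1, 1/2, -1/2} \<longleftrightarrow> a \<in> {0, 1, -1, 1/2, -1/2}" for a :: real by auto
  then show ?thesis
    using assms unfolding two_T_iff_coordinates by (simp only: unit_qcnj qcnj_sel insert_subset)
qed

lemma two_T_mult:
  assumes "x \<in> two_T" "y \<in> two_T"
  shows "x * y \<in> two_T"
proof -
  have u: "x * y \<in> unit_quaternions" using assms two_T_subset_unit by blast
  define S :: "real set" where "S = {0, 1, -1, 1/2, -1/2}"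
  have S: "- a \<in> S \<longleftrightarrow> a \<in> S" "0 \<in> S" for a by (auto simp: S_def)
  have xy: "{qRe x, qI x, qJ x, qK x} \<subseteq> S" "{qRe y, qI y, qJ y, qK y} \<subseteq> S"
    unfolding S_def by (fact assms[THEN two_T_iff_coordinates[THEN iffD1], THEN conjunct2])+
  consider "x \<in> quat_basis" | "y \<in> quat_basis" |
    "{qRe x, qI x, qJ x, qK x} \<subseteq> {1/2, -1/2}" "{qRe y, qI y, qJ y, qK y} \<subseteq> {1/2, -1/2}"
    using assms two_T_iff by blast
  then show ?thesis
  proof cases
    case 1
    have "{qRe (x * y), qI (x * y), qJ (x * y), qK (x * y)} \<subseteq> S"
      using 1 xy(2) S unfolding quat_basis_def insert_iff by (elim disjE) simp_all
    then show ?thesis using u unfolding two_T_iff_coordinates S_def by blast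
  next
    case 2
    have "{qRe (x * y), qI (x * y), qJ (x * y), qK (x * y)} \<subseteq> S"
      using 2 xy(1) S unfolding quat_basis_def insert_iff by (elim disjE) simp_all
    then show ?thesis using u unfolding two_T_iff_coordinates S_def by blast
  next
    case 3
    let ?H = "{1/2, -1/2} :: real set" and ?Q = "{1/4, -1/4} :: real set"
    have prods: "\<forall>a\<in>?H. \<forall>b\<in>?H. a * b \<in> ?Q" by simp
    have sums: "\<forall>p\<in>?Q. \<forall>q\<in>?Q. \<forall>r\<in>?Q. \<forall>s\<in>?Q. p - q - r - s \<in> S"
        "\<forall>p\<in>?Q. \<forall>q\<in>?Q. \<forall>r\<in>?Q. \<forall>s\<in>?Q. p + q + r - s \<in> S"
        "\<forall>p\<in>?Q. \<forall>q\<in>?Q. \<forall>r\<in>?Q. \<forall>s\<in>?Q. p - q + r + s \<in> S"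
        "\<forall>p\<in>?Q. \<forall>q\<in>?Q. \<forall>r\<in>?Q. \<forall>s\<in>?Q. p + q - r + s \<in> S"
      by (simp_all add: S_def)
    have mem: "qRe x \<in> ?H" "qI x \<in> ?H" "qJ x \<in> ?H" "qK x \<in> ?H"
      "qRe y \<in> ?H" "qI y \<in> ?H" "qJ y \<in> ?H" "qK y \<in> ?H"
      using 3 unfolding insert_subset by iprover+
    have "qRe (x * y) \<in> S"
      unfolding quat_sel by (intro sums(1)[rule_format] prods[rule_format] mem)
    moreover have "qI (x * y) \<in> S"
      unfolding quat_sel by (intro sums(2)[rule_format] prods[rule_format] mem)
    moreover have "qJ (x * y) \<in> S"
      unfolding quat_sel by (intro sums(3)[rule_format] prods[rule_format] mem)
    moreover have "qK (x * y) \<in> S"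
      unfolding quat_sel by (intro sums(4)[rule_format] prods[rule_format] mem)
    ultimately show ?thesis using u unfolding two_T_iff_coordinates S_def by blast
  qed
qed

text \<open>If no coordinate of \<open>x\<close> has absolute value at least \<open>\<surd>2/2\<close>, then \<open>e\<^sup>2 \<le> \<bar>e\<bar> \<surd>2/2\<close> for each
coordinate \<open>e\<close>; summing up, the absolute values add up to at least \<open>\<surd>2\<close>, and an element with
coordinates \<open>\<plusminus>1/2\<close> of suitable signs serves as \<open>t\<close>.\<close>

lemma two_T_covering:
  assumes "x \<in> unit_quaternions"
  shows "\<exists>t\<in>two_T. sqrt 2 / 2 \<le> qRe (x * t)"
proof -
  define a b c d where "a = qRe x" "b = qI x" "c = qJ x" "d = qK x"
  note abcd = a_b_c_d_def
  have sq: "a\<^sup>2 + b\<^sup>2 + c\<^sup>2 + d\<^sup>2 = 1" using assms by (simp add: unit_iff abcd)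
  have basis: "t \<in> two_T" if "t \<in> quat_basis" for t using that two_T_iff by blast
  consider "sqrt 2 / 2 \<le> \<bar>a\<bar>" | "sqrt 2 / 2 \<le> \<bar>b\<bar>" | "sqrt 2 / 2 \<le> \<bar>c\<bar>" | "sqrt 2 / 2 \<le> \<bar>d\<bar>" |
    "\<bar>a\<bar> \<le> sqrt 2 / 2" "\<bar>b\<bar> \<le> sqrt 2 / 2" "\<bar>c\<bar> \<le> sqrt 2 / 2" "\<bar>d\<bar> \<le> sqrt 2 / 2"
    by linarith
  then show ?thesis
  proof cases
    case 1
    then show ?thesis
      by (intro bexI[of _ "if 0 \<le> a then 1 else -1"] basis) (auto simp: quat_basis_def abcd)
  next
    case 2
    then show ?thesis
      by (intro bexI[of _ "if 0 \<le> b then Quat 0 (-1) 0 0 else Quat 0 1 0 0"] basis) (auto simp: quat_basis_def abcd)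
  next
    case 3
    then show ?thesis
      by (intro bexI[of _ "if 0 \<le> c then Quat 0 0 (-1) 0 else Quat 0 0 1 0"] basis) (auto simp: quat_basis_def abcd)
  next
    case 4
    then show ?thesis
      by (intro bexI[of _ "if 0 \<le> d then Quat 0 0 0 (-1) else Quat 0 0 0 1"] basis) (auto simp: quat_basis_def abcd)
  next
    case 5
    have "e\<^sup>2 \<le> \<bar>e\<bar> * (sqrt 2 / 2)" if "\<bar>e\<bar> \<le> sqrt 2 / 2" for e
    proof -
      have "e\<^sup>2 = \<bar>e\<bar> * \<bar>e\<bar>" by (simp add: power2_eq_square)
      also have "\<dots> \<le> \<bar>e\<bar> * (sqrt 2 / 2)" using that by (intro mult_left_mono) simp_all
      finally show ?thesis .
    qed
    from this[OF 5(1)] this[OF 5(2)] this[OF 5(3)] this[OF 5(4)]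
    have "1 \<le> (\<bar>a\<bar> + \<bar>b\<bar> + \<bar>c\<bar> + \<bar>d\<bar>) * (sqrt 2 / 2)"
      using sq unfolding distrib_right by linarith
    then have "1 * sqrt 2 \<le> (\<bar>a\<bar> + \<bar>b\<bar> + \<bar>c\<bar> + \<bar>d\<bar>) * (sqrt 2 / 2) * sqrt 2"
      by (intro mult_right_mono) simp_all
    then have sum: "sqrt 2 \<le> \<bar>a\<bar> + \<bar>b\<bar> + \<bar>c\<bar> + \<bar>d\<bar>" by (simp add: mult.assoc)
    \<comment> \<open>The signs are those of the conjugate of \<open>x\<close>, so that every term of \<open>qRe (x * t)\<close> is non-negative.\<close>
    define t where "t = Quat (if 0 \<le> a then 1/2 else -1/2) (if 0 \<le> b then -1/2 else 1/2)
      (if 0 \<le> c then -1/2 else 1/2) (if 0 \<le> d then -1/2 else 1/2)"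
    have "t \<in> two_T" unfolding two_T_iff by (auto simp: t_def)
    moreover have "qRe (x * t) = (\<bar>a\<bar> + \<bar>b\<bar> + \<bar>c\<bar> + \<bar>d\<bar>) / 2"
      by (simp add: t_def abcd[symmetric])
    ultimately show ?thesis using sum by force
  qed
qed

definition tetrahedral_generator :: quat where
  "tetrahedral_generator = Quat (1/2) (1/2) (1/2) (1/2)"

text \<open>Conjugation by the generator \<open>(1 + i + j + k)/2\<close> permutes \<open>i, j, k\<close> cyclically, and every
element with coordinates \<open>\<plusminus>1/2\<close> is the product of a basis element with the generator or its
inverse.\<close>

lemma (in finite_unit_group) two_T_subset:
  assumes i: "Quat 0 1 0 0 \<in> A" and w: "tetrahedral_generator \<in> A"
  shows "two_T \<subseteq> A"
proof -
  have "qconj tetrahedral_generator (Quat 0 1 0 0) = Quat 0 0 1 0"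
    by (simp add: qconj_def tetrahedral_generator_def quat_eq_iff)
  then have j: "Quat 0 0 1 0 \<in> A" using conjugation_closed[OF w i] by simp
  have "Quat 0 1 0 0 * Quat 0 0 1 0 = Quat 0 0 0 1" by (simp add: quat_eq_iff)
  then have k: "Quat 0 0 0 1 \<in> A" using mult[OF i j] by simp
  have "Quat 0 1 0 0 * Quat 0 1 0 0 = -1" by (simp add: quat_eq_iff)
  then have m: "-1 \<in> A" using mult[OF i i] by simp
  have neg: "- x \<in> A" if "x \<in> A" for x using mult[OF m that] by simp
  have basis: "quat_basis \<subseteq> A"
    using one m i j k qcnj[OF i] qcnj[OF j] qcnj[OF k]
    by (simp add: quat_basis_def qcnj_def)
  have half: "u * tetrahedral_generator \<in> A" "u * qcnj tetrahedral_generator \<in> A" if "u \<in> quat_basis" for u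
    using that basis w mult qcnj by blast+
  show ?thesis
  proof
    fix x assume "x \<in> two_T"
    then consider "x \<in> quat_basis" | "{qRe x, qI x, qJ x, qK x} \<subseteq> {1/2, -1/2}"
      using two_T_iff by blast
    then show "x \<in> A"
    proof cases
      case 1
      then show ?thesis using basis by blast
    next
      case 2
      let ?H = "{1/2, -1/2} :: real set"
      have "\<forall>a\<in>?H. \<forall>b\<in>?H. \<forall>c\<in>?H. \<forall>d\<in>?H.
          Quat a b c d * qcnj tetrahedral_generator \<in> quat_basis \<or>
          Quat a b c d * tetrahedral_generator \<in> quat_basis"
        by (simp add: quat_basis_def tetrahedral_generator_def quat_eq_iff)
      moreover have "qRe x \<in> ?H" "qI x \<in> ?H" "qJ x \<in> ?H" "qK x \<in> ?H"
        using 2 unfolding insert_subset by iprover+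
      ultimately have "x * qcnj tetrahedral_generator \<in> quat_basis \<or> x * tetrahedral_generator \<in> quat_basis"
        by (metis quat.collapse)
      then have "x * qcnj tetrahedral_generator * tetrahedral_generator \<in> A \<or>
          x * tetrahedral_generator * qcnj tetrahedral_generator \<in> A"
        using half by blast
      then show ?thesis using is_unit[OF w] by (simp add: mult.assoc)
    qed
  qed
qed

section \<open>Angles between axes of equal order\<close>

text \<open>Two rotations by the same angle yield two real parts, of \<open>g h\<^sup>-\<^sup>1\<close> and \<open>g h\<close>, that lie
symmetrically about \<open>c\<^sup>2\<close>. If both have to belong to a short list, the inner product of the
axes can take few values; the next three lemmas work this out.\<close>

lemma (in finite_unit_group) qRe_products:
  assumes "g \<in> A" "h \<in> A" "qRe g = c" "qRe h = c"
  shows "c * c + qdot g h \<in> qRe ` A" "c * c - qdot g h \<in> qRe ` A"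
  using assms mult[of g h] mult[of g "qcnj h"] qcnj[of h] qRe_mult_qdot[of g h] by (metis imageI)+

context finite_unit_group
begin

lemma abs_qdot_order_6:
  assumes vals: "qRe ` A \<subseteq> {0, 1, -1, 1/2, -1/2}"
    and g: "g \<in> A" "qRe g = 1/2" and h: "h \<in> A" "qRe h = 1/2" and ne: "h \<noteq> g" "h \<noteq> qcnj g"
  shows "\<bar>qdot g h\<bar> = 1/4"
proof -
  have "\<bar>qdot g h\<bar> < 1 - (1/2)\<^sup>2"
    using abs_qdot_less[OF is_unit[OF g(1)] is_unit[OF h(1)] _ ne] g h by simp
  then have b: "\<bar>qdot g h\<bar> < 3/4" by (simp add: power2_eq_square)
  have c: "1/2 * (1/2) = (1/4 :: real)" by simp
  have m: "1/4 + qdot g h \<in> {0, 1, -1, 1/2, -1/2}"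
    using qRe_products(1)[OF g(1) h(1) g(2) h(2)] vals unfolding c by (meson subsetD)
  have lim: "qdot g h < 3/4" "- qdot g h < 3/4" using b by linarith+
  have "qdot g h = 1/4 \<or> qdot g h = -1/4"
    using m unfolding insert_iff empty_iff simp_thms add_divide_distrib diff_divide_distrib minus_diff_eq by (elim disjE) (use lim in linarith)+
  then show ?thesis by auto
qed

lemma qdot_order_8:
  assumes vals: "qRe ` A \<subseteq> {0, 1, -1, 1/2, -1/2, sqrt 2 / 2, - sqrt 2 / 2}"
    and g: "g \<in> A" "qRe g = sqrt 2 / 2" and h: "h \<in> A" "qRe h = sqrt 2 / 2"
    and ne: "h \<noteq> g" "h \<noteq> qcnj g"
  shows "qdot g h = 0"
proof -
  have "\<bar>qdot g h\<bar> < 1 - (sqrt 2 / 2)\<^sup>2"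
    using abs_qdot_less[OF is_unit[OF g(1)] is_unit[OF h(1)] _ ne] g h by simp
  then have b: "\<bar>qdot g h\<bar> < 1/2" by (simp add: power_divide)
  have c: "sqrt 2 / 2 * (sqrt 2 / 2) = 1/2" by simp
  have "1/2 + qdot g h \<in> {0, 1, -1, 1/2, -1/2, sqrt 2 / 2, - sqrt 2 / 2}"
    "1/2 - qdot g h \<in> {0, 1, -1, 1/2, -1/2, sqrt 2 / 2, - sqrt 2 / 2}"
    using qRe_products[OF g(1) h(1) g(2) h(2)] vals unfolding c by (meson subsetD)+
  note m = this
  have lim: "qdot g h < 1/2" "- qdot g h < 1/2" using b by linarith+
  have "1/2 + qdot g h = 1/2 \<or> 1/2 + qdot g h = sqrt 2 / 2"
    using m(1) unfolding insert_iff empty_iff simp_thms add_divide_distrib diff_divide_distrib minus_diff_eq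
    by (elim disjE) (use lim sqrt_2_bounds in linarith)+
  then show ?thesis
  proof
    assume e: "1/2 + qdot g h = sqrt 2 / 2"
    show ?thesis
      using m(2) unfolding insert_iff empty_iff simp_thms add_divide_distrib diff_divide_distrib minus_diff_eq
      by (elim disjE) (use e lim sqrt_2_bounds in linarith)+
  qed simp
qed

lemma abs_qdot_order_10:
  assumes vals: "qRe ` A \<subseteq> {0, 1, -1, 1/2, -1/2, sqrt 2 / 2, - sqrt 2 / 2,
      golden_ratio / 2, - golden_ratio / 2, (golden_ratio - 1) / 2, - (golden_ratio - 1) / 2}"
    and g: "g \<in> A" "qRe g = golden_ratio / 2" and h: "h \<in> A" "qRe h = golden_ratio / 2"
    and ne: "h \<noteq> g" "h \<noteq> qcnj g"
  shows "\<bar>qdot g h\<bar> = (golden_ratio - 1) / 4"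
proof -
  have c: "golden_ratio / 2 * (golden_ratio / 2) = golden_ratio / 4 + 1/4"
    using golden_ratio_square by (simp add: field_simps)
  have "\<bar>qdot g h\<bar> < 1 - (golden_ratio / 2)\<^sup>2"
    using abs_qdot_less[OF is_unit[OF g(1)] is_unit[OF h(1)] _ ne] g h by simp
  then have b: "\<bar>qdot g h\<bar> < 3/4 - golden_ratio / 4" using c by (simp add: power2_eq_square field_simps)
  have m: "golden_ratio / 4 + 1/4 + qdot g h \<in> {0, 1, -1, 1/2, -1/2, sqrt 2 / 2, - sqrt 2 / 2,
      golden_ratio / 2, - golden_ratio / 2, (golden_ratio - 1) / 2, - (golden_ratio - 1) / 2}"
    "(golden_ratio / 4 + 1/4) - qdot g h \<in> {0, 1, -1, 1/2, -1/2, sqrt 2 / 2, - sqrt 2 / 2,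
      golden_ratio / 2, - golden_ratio / 2, (golden_ratio - 1) / 2, - (golden_ratio - 1) / 2}"
    using qRe_products[OF g(1) h(1) g(2) h(2)] vals unfolding c by (meson subsetD)+
  have lim: "qdot g h < 3/4 - golden_ratio / 4" "- qdot g h < 3/4 - golden_ratio / 4"
    using b by linarith+
  have "golden_ratio / 4 + 1/4 + qdot g h = 1/2 \<or> golden_ratio / 4 + 1/4 + qdot g h = sqrt 2 / 2 \<or>
      golden_ratio / 4 + 1/4 + qdot g h = golden_ratio / 2"
    using m(1) unfolding insert_iff empty_iff simp_thms add_divide_distrib diff_divide_distrib minus_diff_eq
    by (elim disjE) (use lim golden_ratio_bounds sqrt_2_bounds in linarith)+
  then have "qdot g h = golden_ratio / 4 - 1/4 \<or> qdot g h = - (golden_ratio / 4 - 1/4)"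
  proof (elim disjE)
    assume e: "golden_ratio / 4 + 1/4 + qdot g h = sqrt 2 / 2"
    show ?thesis
      using m(2) unfolding insert_iff empty_iff simp_thms add_divide_distrib diff_divide_distrib minus_diff_eq
      by (elim disjE) (use e lim golden_ratio_bounds sqrt_2_bounds in linarith)+
  qed (use golden_ratio_bounds in linarith)+
  moreover have "(golden_ratio - 1) / 4 = golden_ratio / 4 - 1/4" "0 < golden_ratio / 4 - 1/4"
    using golden_ratio_bounds by (simp_all add: diff_divide_distrib)
  ultimately show ?thesis by (elim disjE) simp_all
qed

text \<open>The real parts of \<open>g h\<close> and \<open>g h\<^sup>-\<^sup>1\<close> add up to \<open>\<surd>2 \<phi>/2\<close>, about 1.144, which is not the sum of
two listed values. This separates the icosahedral from the octahedral case.\<close>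

lemma no_order_8_with_order_10:
  assumes vals: "qRe ` A \<subseteq> {0, 1, -1, 1/2, -1/2, sqrt 2 / 2, - sqrt 2 / 2,
      golden_ratio / 2, - golden_ratio / 2, (golden_ratio - 1) / 2, - (golden_ratio - 1) / 2}"
    and g: "g \<in> A" "qRe g = golden_ratio / 2" and h: "h \<in> A" "qRe h = sqrt 2 / 2"
  shows False
proof -
  have "sqrt 2 * golden_ratio \<ge> 1414/1000 * (1618/1000)"
    using sqrt_2_bounds golden_ratio_bounds by (intro mult_mono) auto
  moreover have "sqrt 2 * golden_ratio \<le> 14143/10000 * (16181/10000)"
    using sqrt_2_bounds golden_ratio_bounds by (intro mult_mono) auto
  moreover have "qRe (g * h) + qRe (g * qcnj h) = sqrt 2 * golden_ratio / 2"
    unfolding qRe_mult_qdot(1) qdot_qcnj qcnj_sel g h by simp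
  ultimately have sum: "11439/10000 \<le> qRe (g * h) + qRe (g * qcnj h)" "qRe (g * h) + qRe (g * qcnj h) \<le> 11443/10000"
    by linarith+
  have no: False if x: "x \<in> A" and y: "y \<in> A" and s: "11439/10000 \<le> qRe x + qRe y" "qRe x + qRe y \<le> 11443/10000"
    and le: "qRe y \<le> qRe x" for x y
  proof -
    have mx: "qRe x \<in> {0, 1, -1, 1/2, -1/2, sqrt 2 / 2, - sqrt 2 / 2,
      golden_ratio / 2, - golden_ratio / 2, (golden_ratio - 1) / 2, - (golden_ratio - 1) / 2}"
      and my: "qRe y \<in> {0, 1, -1, 1/2, -1/2, sqrt 2 / 2, - sqrt 2 / 2,
      golden_ratio / 2, - golden_ratio / 2, (golden_ratio - 1) / 2, - (golden_ratio - 1) / 2}"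
      using x y vals by blast+
    have "qRe x = 1 \<or> qRe x = sqrt 2 / 2 \<or> qRe x = golden_ratio / 2"
      using mx unfolding insert_iff empty_iff simp_thms add_divide_distrib diff_divide_distrib minus_diff_eq
      by (elim disjE) (use s le golden_ratio_bounds sqrt_2_bounds in linarith)+
    then have "14/100 \<le> qRe y \<and> qRe y \<le> 15/100 \<or> 33/100 \<le> qRe y \<and> qRe y \<le> 44/100"
      using s golden_ratio_bounds sqrt_2_bounds by (elim disjE) linarith+
    then show False
      using my unfolding insert_iff empty_iff simp_thms add_divide_distrib diff_divide_distrib minus_diff_eq
      by (elim disjE) (use golden_ratio_bounds sqrt_2_bounds in linarith)+
  qed
  have "g * h \<in> A" "g * qcnj h \<in> A" using mult qcnj g h by blast+
  then show False
    using no[of "g * h" "g * qcnj h"] no[of "g * qcnj h" "g * h"] sum by linarith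
qed

end

section \<open>The three exceptional groups\<close>

text \<open>The next largest listed real part after 1 is \<open>1/2 < \<surd>2/2\<close>, so the covering property shows that
a translate by an element of \<open>2T\<close> is 1.\<close>

lemma (in finite_unit_group) eq_two_T:
  assumes vals: "qRe ` A \<subseteq> {0, 1, -1, 1/2, -1/2}"
    and w: "tetrahedral_generator \<in> A" and w': "Quat (1/2) (1/2) (1/2) (-1/2) \<in> A"
  shows "A = two_T"
proof
  have "tetrahedral_generator * Quat (1/2) (1/2) (1/2) (-1/2) = quat_j"
    by (simp add: tetrahedral_generator_def quat_eq_iff)
  then have "quat_j \<in> A" using mult[OF w w'] by simp
  moreover have "qconj (qcnj tetrahedral_generator) quat_j = Quat 0 1 0 0"
    by (simp add: qconj_def tetrahedral_generator_def quat_eq_iff)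
  ultimately have "Quat 0 1 0 0 \<in> A" using conjugation_closed qcnj w by metis
  then show T: "two_T \<subseteq> A" using two_T_subset w by blast
  show "A \<subseteq> two_T"
  proof
    fix x assume x: "x \<in> A"
    obtain t where t: "t \<in> two_T" "sqrt 2 / 2 \<le> qRe (x * t)"
      using two_T_covering[OF is_unit[OF x]] by blast
    have xt: "x * t \<in> A" using x t T mult by blast
    then have "qRe (x * t) \<in> {0, 1, -1, 1/2, -1/2}" using vals by blast
    then have "qRe (x * t) = 1"
      unfolding insert_iff empty_iff simp_thms add_divide_distrib diff_divide_distrib minus_diff_eq by (elim disjE) (use t(2) sqrt_2_bounds in linarith)+
    then have e: "x * t = 1" using unit_qRe_eq_1 is_unit xt by blast
    have "x = x * t * qcnj t" using t(1) two_T_subset_unit by (auto simp: mult.assoc)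
    then have "x = qcnj t" using e by simp
    then show "x \<in> two_T" using two_T_qcnj t(1) by simp
  qed
qed

definition octahedral_generator :: quat where
  "octahedral_generator = Quat (sqrt 2 / 2) (sqrt 2 / 2) 0 0"

lemma two_O_eq: "two_O = two_T \<union> (\<lambda>t. octahedral_generator * t) ` two_T"
proof -
  have "quat_of_complex (cis (pi / 4)) = octahedral_generator"
    by (simp add: octahedral_generator_def quat_eq_iff cos_45 sin_45)
  then show ?thesis by (simp add: two_O_def)
qed

lemma two_O_mult_two_T: "x \<in> two_O \<Longrightarrow> t \<in> two_T \<Longrightarrow> x * t \<in> two_O"
  unfolding two_O_eq using two_T_mult by (auto simp: mult.assoc)

lemma half_in_two_T:
  "a \<in> {1/2, -1/2} \<Longrightarrow> b \<in> {1/2, -1/2} \<Longrightarrow> c \<in> {1/2, -1/2} \<Longrightarrow> d \<in> {1/2, -1/2} \<Longrightarrow> Quat a b c d \<in> two_T"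
  unfolding two_T_iff by simp

lemma basis_in_two_T: "t \<in> quat_basis \<Longrightarrow> t \<in> two_T"
  by (simp add: two_T_iff)

lemma order_8_vertices_in_two_O:
  "Quat (sqrt 2 / 2) (sqrt 2 / 2) 0 0 \<in> two_O" "Quat (sqrt 2 / 2) (- sqrt 2 / 2) 0 0 \<in> two_O"
  "Quat (sqrt 2 / 2) 0 (sqrt 2 / 2) 0 \<in> two_O" "Quat (sqrt 2 / 2) 0 (- sqrt 2 / 2) 0 \<in> two_O"
  "Quat (sqrt 2 / 2) 0 0 (sqrt 2 / 2) \<in> two_O" "Quat (sqrt 2 / 2) 0 0 (- sqrt 2 / 2) \<in> two_O"
proof -
  have I: "x \<in> two_O" if "x = octahedral_generator * t" "t \<in> two_T" for x t
    unfolding two_O_eq that(1) using that(2) by blast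
  note simps = octahedral_generator_def quat_eq_iff quat_basis_def
  show "Quat (sqrt 2 / 2) (sqrt 2 / 2) 0 0 \<in> two_O"
    by (rule I[of _ 1]) (simp_all add: simps basis_in_two_T)
  show "Quat (sqrt 2 / 2) (- sqrt 2 / 2) 0 0 \<in> two_O"
    by (rule I[of _ "Quat 0 (-1) 0 0"]) (simp_all add: simps basis_in_two_T)
  show "Quat (sqrt 2 / 2) 0 (sqrt 2 / 2) 0 \<in> two_O"
    by (rule I[of _ "Quat (1/2) (-1/2) (1/2) (-1/2)"]) (simp_all add: simps half_in_two_T)
  show "Quat (sqrt 2 / 2) 0 (- sqrt 2 / 2) 0 \<in> two_O"
    by (rule I[of _ "Quat (1/2) (-1/2) (-1/2) (1/2)"]) (simp_all add: simps half_in_two_T)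
  show "Quat (sqrt 2 / 2) 0 0 (sqrt 2 / 2) \<in> two_O"
    by (rule I[of _ "Quat (1/2) (-1/2) (1/2) (1/2)"]) (simp_all add: simps half_in_two_T)
  show "Quat (sqrt 2 / 2) 0 0 (- sqrt 2 / 2) \<in> two_O"
    by (rule I[of _ "Quat (1/2) (-1/2) (-1/2) (-1/2)"]) (simp_all add: simps half_in_two_T)
qed

text \<open>An element of \<open>A\<close> with real part \<open>\<surd>2/2\<close> outside \<open>2O\<close> would have an axis orthogonal to \<open>i\<close>, \<open>j\<close> and \<open>k\<close>.\<close>

lemma (in finite_unit_group) eq_two_O:
  assumes vals: "qRe ` A \<subseteq> {0, 1, -1, 1/2, -1/2, sqrt 2 / 2, - sqrt 2 / 2}"
    and g: "octahedral_generator \<in> A" and h: "Quat (sqrt 2 / 2) 0 (sqrt 2 / 2) 0 \<in> A"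
  shows "A = two_O"
proof
  have "octahedral_generator * Quat (sqrt 2 / 2) 0 (sqrt 2 / 2) 0 = tetrahedral_generator"
    by (simp add: tetrahedral_generator_def octahedral_generator_def quat_eq_iff)
  then have w: "tetrahedral_generator \<in> A" using mult[OF g h] by simp
  have "octahedral_generator * octahedral_generator = Quat 0 1 0 0"
    by (simp add: octahedral_generator_def quat_eq_iff)
  then have "Quat 0 1 0 0 \<in> A" using mult[OF g g] by simp
  then have T: "two_T \<subseteq> A" using two_T_subset w by blast
  then show "two_O \<subseteq> A" unfolding two_O_eq using mult g by blast
  have "qconj tetrahedral_generator (Quat (sqrt 2 / 2) 0 (sqrt 2 / 2) 0) = Quat (sqrt 2 / 2) 0 0 (sqrt 2 / 2)"
    by (simp add: qconj_def tetrahedral_generator_def quat_eq_iff)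
  then have k: "Quat (sqrt 2 / 2) 0 0 (sqrt 2 / 2) \<in> A" using conjugation_closed[OF w h] by simp
  show "A \<subseteq> two_O"
  proof
    fix x assume x: "x \<in> A"
    obtain t where t: "t \<in> two_T" "sqrt 2 / 2 \<le> qRe (x * t)"
      using two_T_covering[OF is_unit[OF x]] by blast
    define y where "y = x * t"
    have y: "y \<in> A" using x t T mult unfolding y_def by blast
    then have "qRe y \<in> {0, 1, -1, 1/2, -1/2, sqrt 2 / 2, - sqrt 2 / 2}" using vals by blast
    then have "qRe y = 1 \<or> qRe y = sqrt 2 / 2"
      unfolding insert_iff empty_iff simp_thms add_divide_distrib diff_divide_distrib minus_diff_eq
      by (elim disjE) (use t(2) sqrt_2_bounds in \<open>simp_all flip: y_def\<close>)
    then have "y \<in> two_O"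
    proof
      assume "qRe y = 1"
      then have "y = 1" using unit_qRe_eq_1 is_unit y by blast
      then show ?thesis unfolding two_O_eq by (simp add: basis_in_two_T quat_basis_def)
    next
      assume r: "qRe y = sqrt 2 / 2"
      show ?thesis
      proof (rule ccontr)
        assume n: "y \<notin> two_O"
        have "y \<noteq> octahedral_generator" "y \<noteq> qcnj octahedral_generator"
          using n order_8_vertices_in_two_O by (auto simp: octahedral_generator_def qcnj_def)
        from qdot_order_8[OF vals g _ y r this]
        have "qI y = 0" by (simp add: octahedral_generator_def qdot_def)
        moreover
        have "y \<noteq> Quat (sqrt 2 / 2) 0 (sqrt 2 / 2) 0" "y \<noteq> qcnj (Quat (sqrt 2 / 2) 0 (sqrt 2 / 2) 0)"
          using n order_8_vertices_in_two_O by (auto simp: qcnj_def)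
        from qdot_order_8[OF vals h _ y r this]
        have "qJ y = 0" by (simp add: qdot_def)
        moreover
        have "y \<noteq> Quat (sqrt 2 / 2) 0 0 (sqrt 2 / 2)" "y \<noteq> qcnj (Quat (sqrt 2 / 2) 0 0 (sqrt 2 / 2))"
          using n order_8_vertices_in_two_O by (auto simp: qcnj_def)
        from qdot_order_8[OF vals k _ y r this]
        have "qK y = 0" by (simp add: qdot_def)
        ultimately show False
          using is_unit[OF y] r by (simp add: unit_iff power_divide)
      qed
    qed
    then have "y * qcnj t \<in> two_O" using two_O_mult_two_T two_T_qcnj t(1) by blast
    moreover have "y * qcnj t = x" using t(1) two_T_subset_unit by (auto simp: y_def mult.assoc)
    ultimately show "x \<in> two_O" by simp
  qed
qed

lemma icosian_q_eq: "icosian_q = Quat (golden_ratio / 2) ((golden_ratio - 1) / 2) (1/2) 0"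
  by (simp add: icosian_q_def inverse_golden_ratio)

lemma icosian_q_powers:
  "icosian_q ^ 2 = Quat ((golden_ratio - 1) / 2) (1/2) (golden_ratio / 2) 0"
  "icosian_q ^ 3 = Quat (- (golden_ratio - 1) / 2) (1/2) (golden_ratio / 2) 0"
  "icosian_q ^ 4 = Quat (- golden_ratio / 2) ((golden_ratio - 1) / 2) (1/2) 0"
proof -
  show 2: "icosian_q ^ 2 = Quat ((golden_ratio - 1) / 2) (1/2) (golden_ratio / 2) 0"
    using golden_ratio_square by (simp add: power2_eq_square icosian_q_eq quat_eq_iff field_simps)
  have "icosian_q ^ 3 = icosian_q ^ 2 * icosian_q"
    by (simp add: eval_nat_numeral mult.assoc)
  then show "icosian_q ^ 3 = Quat (- (golden_ratio - 1) / 2) (1/2) (golden_ratio / 2) 0"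
    using golden_ratio_square unfolding 2 by (simp add: icosian_q_eq quat_eq_iff field_simps)
  have "icosian_q ^ 4 = icosian_q ^ 2 * icosian_q ^ 2"
    by (simp add: eval_nat_numeral mult.assoc)
  then show "icosian_q ^ 4 = Quat (- golden_ratio / 2) ((golden_ratio - 1) / 2) (1/2) 0"
    using golden_ratio_square unfolding 2 by (simp add: quat_eq_iff field_simps)
qed

lemma two_I_memI: "s \<le> 4 \<Longrightarrow> t \<in> two_T \<Longrightarrow> x = icosian_q ^ s * t \<Longrightarrow> x \<in> two_I"
  unfolding two_I_def by auto

lemma two_T_subset_two_I: "two_T \<subseteq> two_I"
  using two_I_memI[of 0] by auto

lemma two_I_mult_two_T: "x \<in> two_I \<Longrightarrow> t \<in> two_T \<Longrightarrow> x * t \<in> two_I"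
  unfolding two_I_def using two_T_mult by (force simp: mult.assoc)

text \<open>The twelve elements with real part \<open>\<phi>/2\<close>, whose axes point to the vertices of an icosahedron.\<close>

lemma order_10_vertices_in_two_I:
  fixes f :: real
  defines "f \<equiv> (golden_ratio - 1) / 2"
  shows "Quat (golden_ratio / 2) f (1/2) 0 \<in> two_I"
    "Quat (golden_ratio / 2) f (-1/2) 0 \<in> two_I"
    "Quat (golden_ratio / 2) (- f) (1/2) 0 \<in> two_I"
    "Quat (golden_ratio / 2) (- f) (-1/2) 0 \<in> two_I"
    "Quat (golden_ratio / 2) 0 f (1/2) \<in> two_I"
    "Quat (golden_ratio / 2) 0 f (-1/2) \<in> two_I"
    "Quat (golden_ratio / 2) 0 (- f) (1/2) \<in> two_I"
    "Quat (golden_ratio / 2) 0 (- f) (-1/2) \<in> two_I"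
    "Quat (golden_ratio / 2) (1/2) 0 f \<in> two_I"
    "Quat (golden_ratio / 2) (-1/2) 0 f \<in> two_I"
    "Quat (golden_ratio / 2) (1/2) 0 (- f) \<in> two_I"
    "Quat (golden_ratio / 2) (-1/2) 0 (- f) \<in> two_I"
proof -
  have simps: "icosian_q ^ 1 = Quat (golden_ratio / 2) ((golden_ratio - 1) / 2) (1/2) 0"
    by (simp add: icosian_q_eq)
  note simps = simps icosian_q_powers quat_eq_iff f_def quat_basis_def
  show "Quat (golden_ratio / 2) f (1/2) 0 \<in> two_I"
    by (rule two_I_memI[of 1 1]) (simp_all only: simps quat_sel, simp_all add: basis_in_two_T quat_basis_def field_simps)
  show "Quat (golden_ratio / 2) f (-1/2) 0 \<in> two_I"
    by (rule two_I_memI[of 3 "Quat (-1/2) (-1/2) (-1/2) (1/2)"])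
      (simp_all only: simps quat_sel, simp_all add: half_in_two_T field_simps)
  show "Quat (golden_ratio / 2) (- f) (1/2) 0 \<in> two_I"
    by (rule two_I_memI[of 2 "Quat (1/2) (-1/2) (-1/2) (-1/2)"])
      (simp_all only: simps quat_sel, simp_all add: half_in_two_T field_simps)
  show "Quat (golden_ratio / 2) (- f) (-1/2) 0 \<in> two_I"
    by (rule two_I_memI[of 4 "-1"]) (simp_all only: simps quat_sel, simp_all add: basis_in_two_T quat_basis_def field_simps)
  show "Quat (golden_ratio / 2) 0 f (1/2) \<in> two_I"
    by (rule two_I_memI[of 4 "Quat (-1/2) (-1/2) (-1/2) (-1/2)"])
      (simp_all only: simps quat_sel, simp_all add: half_in_two_T field_simps)
  show "Quat (golden_ratio / 2) 0 f (-1/2) \<in> two_I"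
    by (rule two_I_memI[of 3 "Quat 0 0 (-1) 0"])
      (simp_all only: simps quat_sel, simp_all add: basis_in_two_T quat_basis_def field_simps)
  show "Quat (golden_ratio / 2) 0 (- f) (1/2) \<in> two_I"
    by (rule two_I_memI[of 1 "Quat (1/2) (-1/2) (-1/2) (1/2)"])
      (simp_all only: simps quat_sel, simp_all add: half_in_two_T field_simps)
  show "Quat (golden_ratio / 2) 0 (- f) (-1/2) \<in> two_I"
    by (rule two_I_memI[of 2 "Quat 0 0 (-1) 0"])
      (simp_all only: simps quat_sel, simp_all add: basis_in_two_T quat_basis_def field_simps)
  show "Quat (golden_ratio / 2) (1/2) 0 f \<in> two_I"
    by (rule two_I_memI[of 2 "Quat (1/2) (-1/2) (-1/2) (1/2)"])
      (simp_all only: simps quat_sel, simp_all add: half_in_two_T field_simps)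
  show "Quat (golden_ratio / 2) (-1/2) 0 f \<in> two_I"
    by (rule two_I_memI[of 3 "Quat (-1/2) (-1/2) (-1/2) (-1/2)"])
      (simp_all only: simps quat_sel, simp_all add: half_in_two_T field_simps)
  show "Quat (golden_ratio / 2) (1/2) 0 (- f) \<in> two_I"
    by (rule two_I_memI[of 4 "Quat (-1/2) (-1/2) (-1/2) (1/2)"])
      (simp_all only: simps quat_sel, simp_all add: half_in_two_T field_simps)
  show "Quat (golden_ratio / 2) (-1/2) 0 (- f) \<in> two_I"
    by (rule two_I_memI[of 1 "Quat (1/2) (-1/2) (-1/2) (-1/2)"])
      (simp_all only: simps quat_sel, simp_all add: half_in_two_T field_simps)
qed

text \<open>Together with \<open>icosian_q\<close>, a pair of rotations about neighbouring vertices of the icosahedron.\<close>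

definition icosian_p :: quat where
  "icosian_p = Quat (golden_ratio / 2) (1/2) 0 ((golden_ratio - 1) / 2)"

text \<open>An element of \<open>A\<close> with real part \<open>\<phi>/2\<close> outside \<open>2I\<close> would have an axis making the same angle, up to
sign, with all vertices of the icosahedron. Comparing the vertices \<open>(f, \<plusminus>1/2, 0)\<close> and their
cyclic shifts shows that any two of its coordinates have product 0, so two of them vanish, and
then the axis is orthogonal to a vertex.\<close>

lemma (in finite_unit_group) eq_two_I:
  assumes vals: "qRe ` A \<subseteq> {0, 1, -1, 1/2, -1/2, sqrt 2 / 2, - sqrt 2 / 2,
      golden_ratio / 2, - golden_ratio / 2, (golden_ratio - 1) / 2, - (golden_ratio - 1) / 2}"
    and q: "icosian_q \<in> A" and p: "icosian_p \<in> A"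
  shows "A = two_I"
proof
  have "icosian_p * icosian_q = tetrahedral_generator"
    using golden_ratio_square
    by (simp add: tetrahedral_generator_def icosian_p_def icosian_q_eq quat_eq_iff field_simps)
  then have w: "tetrahedral_generator \<in> A" using mult[OF p q] by simp
  have pp: "icosian_p * icosian_p = Quat ((golden_ratio - 1) / 2) (golden_ratio / 2) 0 (1/2)"
    using golden_ratio_square by (simp add: icosian_p_def quat_eq_iff field_simps)
  have "icosian_q * (icosian_p * icosian_p) = Quat 0 1 0 0"
    using golden_ratio_square unfolding pp by (simp add: icosian_q_eq quat_eq_iff field_simps)
  then have "Quat 0 1 0 0 \<in> A" using mult[OF q mult[OF p p]] by simp
  then have T: "two_T \<subseteq> A" using two_T_subset w by blast
  have "icosian_q ^ s \<in> A" for s by (induction s) (simp_all add: one mult q)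
  then show I: "two_I \<subseteq> A" unfolding two_I_def using mult T by blast
  have q_Re: "qRe icosian_q = golden_ratio / 2" by (simp add: icosian_q_eq)
  define f where "f = (golden_ratio - 1) / 2"
  have f: "0 < f" using golden_ratio_bounds by (simp add: f_def)
  note V = order_10_vertices_in_two_I[folded f_def]
  show "A \<subseteq> two_I"
  proof
    fix x assume x: "x \<in> A"
    obtain t where t: "t \<in> two_T" "sqrt 2 / 2 \<le> qRe (x * t)"
      using two_T_covering[OF is_unit[OF x]] by blast
    define y where "y = x * t"
    have y: "y \<in> A" using x t T mult unfolding y_def by blast
    have ge: "sqrt 2 / 2 \<le> qRe y" using t(2) by (simp only: y_def)
    have "qRe y \<in> {0, 1, -1, 1/2, -1/2, sqrt 2 / 2, - sqrt 2 / 2,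
      golden_ratio / 2, - golden_ratio / 2, (golden_ratio - 1) / 2, - (golden_ratio - 1) / 2}"
      using vals y by blast
    then have "qRe y = 1 \<or> qRe y = sqrt 2 / 2 \<or> qRe y = golden_ratio / 2"
      unfolding insert_iff empty_iff simp_thms add_divide_distrib diff_divide_distrib minus_diff_eq
      by (elim disjE) (use ge sqrt_2_bounds golden_ratio_bounds in linarith)+
    then consider "qRe y = 1" | "qRe y = golden_ratio / 2"
      using no_order_8_with_order_10[OF vals q q_Re y] by blast
    then have "y \<in> two_I"
    proof cases
      case 1
      then have "y = 1" using unit_qRe_eq_1 is_unit y by blast
      then show ?thesis using two_T_subset_two_I by (auto simp: basis_in_two_T quat_basis_def)
    next
      case r: 2
      show ?thesis
      proof (rule ccontr)
        assume n: "y \<notin> two_I"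
        have dot: "\<bar>qdot (Quat (golden_ratio / 2) b c d) y\<bar> = f / 2"
          if "Quat (golden_ratio / 2) b c d \<in> two_I" "Quat (golden_ratio / 2) (- b) (- c) (- d) \<in> two_I" for b c d
          unfolding f_def using abs_qdot_order_10[OF vals _ _ y r, of "Quat (golden_ratio / 2) b c d"] that n I
          by (auto simp: qcnj_def)
        define b c d where "b = qI y" and "c = qJ y" and "d = qK y"
        note bcd = b_def[symmetric] c_def[symmetric] d_def[symmetric]
        have 1: "\<bar>f * b + c / 2\<bar> = f / 2" "\<bar>f * b - c / 2\<bar> = f / 2"
          using dot[OF V(1)] dot[OF V(2)] V(1-4) by (simp_all add: qdot_def bcd)
        have 2: "\<bar>f * c + d / 2\<bar> = f / 2" "\<bar>f * c - d / 2\<bar> = f / 2"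
          using dot[OF V(5)] dot[OF V(6)] V(5-8) by (simp_all add: qdot_def bcd)
        have 3: "\<bar>f * d + b / 2\<bar> = f / 2" "\<bar>f * d - b / 2\<bar> = f / 2"
          using dot[OF V(9)] dot[OF V(10)] V(9-12) by (simp_all add: qdot_def bcd add.commute)
        have orth: "u = 0 \<or> v = 0" if "\<bar>f * u + v / 2\<bar> = f / 2" "\<bar>f * u - v / 2\<bar> = f / 2" for u v
        proof -
          have "(f * u + v / 2)\<^sup>2 = (f * u - v / 2)\<^sup>2"
            using that by (metis power2_abs)
          then have "f * (u * v) = 0" by (simp add: power2_eq_square algebra_simps)
          then show ?thesis using f by simp
        qed
        show False
          using orth[OF 1] orth[OF 2] orth[OF 3] 1(1) 2(1) 3(1) f by auto
      qed
    qed
    then have "y * qcnj t \<in> two_I" using two_I_mult_two_T two_T_qcnj t(1) by blast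
    moreover have "y * qcnj t = x" using t(1) two_T_subset_unit by (auto simp: y_def mult.assoc)
    ultimately show "x \<in> two_I" by simp
  qed
qed

section \<open>Classification up to conjugation\<close>

definition ade_model :: "quat set \<Rightarrow> bool" where
  "ade_model B \<longleftrightarrow> (\<exists>n\<ge>2. B = cyclic_Z n) \<or> (\<exists>n\<ge>2. B = two_D n) \<or>
     B = two_T \<or> B = two_O \<or> B = two_I"

lemma cyclic_Z_2: "cyclic_Z 2 = {1, -1}"
proof -
  have val: "quat_of_complex (cis (2 * pi * real_of_int x / real 2)) = (if even x then 1 else -1)" for x
    by (simp add: quat_eq_iff cos_npi_int sin_npi_int)
  have mem: "quat_of_complex (cis (2 * pi * real_of_int x / real 2)) \<in> cyclic_Z 2" for x
    unfolding cyclic_Z_def by blast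
  show ?thesis
  proof
    show "cyclic_Z 2 \<subseteq> {1, -1}" unfolding cyclic_Z_def by (auto simp only: val split: if_splits)
    show "{1, -1} \<subseteq> cyclic_Z 2" using mem[of 0] mem[of 1] unfolding val by simp
  qed
qed

lemma (in finite_unit_group) conj_to_standard_pair:
  assumes g: "g \<in> A" "qRe g = c" "c\<^sup>2 \<noteq> 1" and h: "h \<in> A" "qRe h = c" and dot: "\<bar>qdot g h\<bar> = D"
    and std: "g' \<in> unit_quaternions" "h' \<in> unit_quaternions" "qRe g' = c" "qRe h' = c" "qdot g' h' = D"
  shows "\<exists>w\<in>unit_quaternions. g' \<in> qconj w ` A \<and> h' \<in> qconj w ` A"
proof -
  obtain k where k: "k \<in> A" "qRe k = c" "qdot g k = D"
  proof (cases "0 \<le> qdot g h")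
    case True
    then show ?thesis using that[of h] h dot by simp
  next
    case False
    then show ?thesis using that[of "qcnj h"] h dot qcnj by (simp add: qdot_qcnj)
  qed
  have "qRe (g * qcnj k) = qRe (g' * qcnj h')"
    using g k std by (simp only: qRe_mult_qdot(2))
  then obtain w where "w \<in> unit_quaternions" "qconj w g = g'" "qconj w k = h'"
    using conj_pair[of g k g' h'] is_unit g k std by metis
  then show ?thesis using g k by blast
qed

text \<open>With these real parts, elements of order 4 with different axes are orthogonal, hence
anticommute.\<close>

lemma (in finite_unit_group) order_4_normalises_axis:
  assumes vals: "qRe ` A \<subseteq> {0, 1, -1}" and g: "g \<in> A" "qRe g = 0" and k: "k \<in> A"
  shows "qconj k g \<in> {g, qcnj g}"
proof -
  note u = is_unit[OF g(1)] is_unit[OF k]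
  consider "k = g" | "k = qcnj g" | "qRe k = 1" | "qRe k = -1" | "qRe k = 0" "k \<noteq> g" "k \<noteq> qcnj g"
    using vals k by blast
  then show ?thesis
  proof cases
    case 5
    have "\<bar>qdot g k\<bar> < 1" using abs_qdot_less[OF u _ 5(2,3)] g 5 by simp
    moreover have "qdot g k \<in> {0, 1, -1}"
      using qRe_products(1)[OF g(1) k g(2) 5(1)] vals by auto
    ultimately have "qdot g k = 0" by auto
    then have "k * g = qcnj g * k"
      using g 5 by (simp add: qdot_def quat_eq_iff algebra_simps)
    then have "qconj k g = qcnj g" using u by (simp add: qconj_def mult.assoc)
    then show ?thesis by simp
  next
    case 3
    then have "k = 1" using unit_qRe_eq_1 u by blast
    then show ?thesis by (simp add: qconj_by_one)
  next
    case 4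
    then have "k = -1" using unit_qRe_eq_minus_1 u by blast
    then show ?thesis by (simp add: qconj_def quat_eq_iff)
  qed (use u in \<open>simp_all add: qconj_def mult.assoc\<close>)
qed

lemma (in finite_unit_group) conj_to_ade_model:
  assumes minus: "-1 \<in> A"
  shows "\<exists>w\<in>unit_quaternions. ade_model (qconj w ` A)"
proof -
  obtain n :: nat and g where n: "n \<ge> 1" and g: "g \<in> A" "qRe g = cos (pi / n)"
    and max: "\<forall>x\<in>A. x \<noteq> 1 \<longrightarrow> qRe x \<le> cos (pi / n)"
    using exists_max_qRe[OF minus] by blast
  note re_vals = qRe_values[OF minus max]
  have image: "qRe ` qconj w ` A = qRe ` A" if "w \<in> unit_quaternions" for w
    using that by (simp add: image_image)
  show ?thesis
  proof (cases "n = 1")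
    case True
    have "x \<in> {1, -1}" if "x \<in> A" for x
      using re_vals(1)[OF that True] unit_qRe_eq_1 unit_qRe_eq_minus_1 is_unit that by blast
    then have "A = {1, -1}" using one minus by blast
    then have "qconj 1 ` A = cyclic_Z 2" by (simp add: cyclic_Z_2 qconj_by_one)
    then show ?thesis unfolding ade_model_def by (intro bexI[of _ 1]) auto
  next
    case False
    then have n2: "n \<ge> 2" using n by simp
    have "cos (pi / 2) \<le> cos (pi / n)" using cos_pi_div_le_iff[of 2 n] n2 by simp
    then have c: "0 \<le> cos (pi / n)" "cos (pi / n) < 1"
      using cos_pi_div_less_1[OF n] by simp_all
    then have c1: "(cos (pi / n))\<^sup>2 \<noteq> 1" by (simp add: power2_eq_1_iff)
    show ?thesis
    proof (cases "\<forall>k\<in>A. qconj k g \<in> {g, qcnj g}")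
      case True
      then show ?thesis using cyclic_or_two_D[OF minus g(1)] c1 g(2) unfolding ade_model_def by metis
    next
      case False
      then obtain k where k: "k \<in> A" "qconj k g \<notin> {g, qcnj g}" by blast
      define h where "h = qconj k g"
      have h: "h \<in> A" "qRe h = cos (pi / n)" and ne: "h \<noteq> g" "h \<noteq> qcnj g"
        using conjugation_closed g k is_unit by (simp_all add: h_def)
      \<comment> \<open>For \<open>n \<ge> 6\<close> the maximum satisfies \<open>c \<ge> cos (\<pi>/6) = \<surd>3/2\<close>.\<close>
      have "n < 6"
      proof (rule ccontr)
        assume "\<not> n < 6"
        then have "cos (pi / 6) \<le> cos (pi / n)" using cos_pi_div_le_iff[of 6 n] n by simp
        then have ge: "sqrt 3 / 2 \<le> cos (pi / n)" by (simp add: cos_30)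
        then have "(sqrt 3 / 2)\<^sup>2 \<le> (cos (pi / n))\<^sup>2" by (intro power_mono) simp_all
        then have "3 / 4 \<le> (cos (pi / n))\<^sup>2" by (simp add: power_divide)
        moreover have "0 < cos (pi / n)" by (rule less_le_trans[OF _ ge]) simp
        ultimately show False
          using unique_axis_of_small_rotation[OF _ _ c(2) g h] ne by blast
      qed
      then consider "n = 2" | "n = 3" | "n = 4" | "n = 5" using n2 by linarith
      then show ?thesis
      proof cases
        case 1
        then have "qRe ` A \<subseteq> {0, 1, -1}" using re_vals(2) by blast
        then show ?thesis using order_4_normalises_axis[of g k] g k 1 by simp
      next
        case n: 2
        have vals: "qRe ` A \<subseteq> {0, 1, -1, 1/2, -1/2}" using re_vals(3) n by blast
        have cn: "cos (pi / n) = 1/2" by (simp add: n cos_60)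
        let ?h = "Quat (1/2) (1/2) (1/2) (-1/2)"
        have "\<exists>w\<in>unit_quaternions. tetrahedral_generator \<in> qconj w ` A \<and> ?h \<in> qconj w ` A"
        proof (rule conj_to_standard_pair[OF g c1 h])
          show "\<bar>qdot g h\<bar> = 1/4" using abs_qdot_order_6[OF vals] g h ne cn by simp
        qed (use cn in \<open>simp_all add: power2_eq_square tetrahedral_generator_def unit_iff qdot_def\<close>)
        then obtain w where w: "w \<in> unit_quaternions" "tetrahedral_generator \<in> qconj w ` A" "?h \<in> qconj w ` A"
          by blast
        have "qconj w ` A = two_T"
          using finite_unit_group.eq_two_T[OF qconj_image[OF w(1)]] w vals by (simp only: image)
        then show ?thesis using w(1) unfolding ade_model_def by blast
      next
        case n: 3
        have vals: "qRe ` A \<subseteq> {0, 1, -1, 1/2, -1/2, sqrt 2 / 2, - sqrt 2 / 2}" using re_vals(4) n by blast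
        have cn: "cos (pi / n) = sqrt 2 / 2" by (simp add: n cos_45)
        let ?h = "Quat (sqrt 2 / 2) 0 (sqrt 2 / 2) 0"
        have "\<exists>w\<in>unit_quaternions. octahedral_generator \<in> qconj w ` A \<and> ?h \<in> qconj w ` A"
        proof (rule conj_to_standard_pair[OF g c1 h])
          show "\<bar>qdot g h\<bar> = 0" using qdot_order_8[OF vals] g h ne cn by simp
        qed (use cn in \<open>simp_all add: power_divide octahedral_generator_def unit_iff qdot_def\<close>)
        then obtain w where w: "w \<in> unit_quaternions" "octahedral_generator \<in> qconj w ` A" "?h \<in> qconj w ` A"
          by blast
        have "qconj w ` A = two_O"
          using finite_unit_group.eq_two_O[OF qconj_image[OF w(1)]] w vals by (simp only: image)
        then show ?thesis using w(1) unfolding ade_model_def by blast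
      next
        case n: 4
        have vals: "qRe ` A \<subseteq> {0, 1, -1, 1/2, -1/2, sqrt 2 / 2, - sqrt 2 / 2,
          golden_ratio / 2, - golden_ratio / 2, (golden_ratio - 1) / 2, - (golden_ratio - 1) / 2}"
          using re_vals(5) n by blast
        have cn: "cos (pi / n) = golden_ratio / 2" by (simp add: n cos_pi_fifth)
        have "\<exists>w\<in>unit_quaternions. icosian_q \<in> qconj w ` A \<and> icosian_p \<in> qconj w ` A"
        proof (rule conj_to_standard_pair[OF g c1 h])
          show "\<bar>qdot g h\<bar> = (golden_ratio - 1) / 4" using abs_qdot_order_10[OF vals] g h ne cn by simp
          have sq: "golden_ratio\<^sup>2 = golden_ratio + 1" "(golden_ratio - 1)\<^sup>2 = 2 - golden_ratio"
            using golden_ratio_square by (simp_all add: power2_eq_square algebra_simps)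
          show "icosian_q \<in> unit_quaternions" "icosian_p \<in> unit_quaternions"
            unfolding unit_iff icosian_q_eq icosian_p_def by (simp_all add: power_divide sq) (simp_all add: field_simps)
        qed (use cn in \<open>simp_all add: icosian_q_eq icosian_p_def qdot_def\<close>)
        then obtain w where w: "w \<in> unit_quaternions" "icosian_q \<in> qconj w ` A" "icosian_p \<in> qconj w ` A"
          by blast
        have "qconj w ` A = two_I"
          using finite_unit_group.eq_two_I[OF qconj_image[OF w(1)]] w vals by (simp only: image)
        then show ?thesis using w(1) unfolding ade_model_def by blast
      qed
    qed
  qed
qed

text \<open>Used to recognise these models: a group containing \<open>j\<close> or \<open>-j\<close> contains their square \<open>-1\<close>.\<close>

lemma quat_j_in_models:
  "n \<ge> 1 \<Longrightarrow> quat_j \<in> two_D n" "quat_j \<in> two_T" "quat_j \<in> two_O" "quat_j \<in> two_I"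
proof -
  have "quat_of_complex (cis (pi * real_of_int 0 / n)) = 1" by (simp add: quat_eq_iff)
  then have "quat_j = quat_j * quat_of_complex (cis (pi * real_of_int 0 / n))" by simp
  then show "quat_j \<in> two_D n" unfolding two_D_def by blast
  show T: "quat_j \<in> two_T" by (simp add: basis_in_two_T quat_basis_def quat_j_def)
  show "quat_j \<in> two_O" "quat_j \<in> two_I" using T two_O_eq two_T_subset_two_I by blast+
qed

lemma qconj_minus_one: "w \<in> unit_quaternions \<Longrightarrow> qconj w (-1) = -1"
  by (simp add: qconj_uminus)

text \<open>If \<open>-1\<close> is missing, classify the group generated by \<open>A\<close> and \<open>-1\<close>. Every non-cyclic model
contains \<open>j\<close>; then \<open>j\<close> or \<open>-j\<close> would lie in the conjugate of \<open>A\<close>, and so would its square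
\<open>-1\<close>. Hence the extended group is conjugate to a group of complex numbers, and \<open>A\<close> is cyclic.\<close>

lemma (in finite_unit_group) conj_to_ade_model_of_nontrivial:
  assumes nontrivial: "A \<noteq> {1}"
  shows "\<exists>w\<in>unit_quaternions. ade_model (qconj w ` A)"
proof (cases "-1 \<in> A")
  case True
  then show ?thesis by (rule conj_to_ade_model)
next
  case False
  define A' where "A' = A \<union> uminus ` A"
  interpret A': finite_unit_group A'
  proof
    show "finite A'" using finite by (simp add: A'_def)
    show "A' \<subseteq> unit_quaternions" using unit by (auto simp: A'_def unit_iff)
    show "1 \<in> A'" using one by (simp add: A'_def)
    show "x * y \<in> A'" if "x \<in> A'" "y \<in> A'" for x y
      using that mult by (auto simp: A'_def)
    have "qcnj (- x) = - qcnj x" for x by (simp add: quat_eq_iff)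
    then show "qcnj x \<in> A'" if "x \<in> A'" for x
      using that qcnj by (auto simp: A'_def)
  qed
  have "-1 \<in> A'" using one by (simp add: A'_def)
  then obtain w where w: "w \<in> unit_quaternions" "ade_model (qconj w ` A')"
    using A'.conj_to_ade_model by blast
  interpret B: finite_unit_group "qconj w ` A" by (rule qconj_image[OF w(1)])
  have mB: "-1 \<notin> qconj w ` A"
  proof
    assume "-1 \<in> qconj w ` A"
    then obtain x where "x \<in> A" "qconj w x = qconj w (-1)" using w(1) qconj_minus_one by force
    then show False using False w(1) by (metis qconj_inverse)
  qed
  have "quat_j \<notin> qconj w ` A'"
  proof
    assume "quat_j \<in> qconj w ` A'"
    then obtain x where "x \<in> A" "quat_j = qconj w x \<or> quat_j = - qconj w x"
      by (auto simp: A'_def qconj_uminus)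
    then have "quat_j \<in> qconj w ` A \<or> - quat_j \<in> qconj w ` A"
      by (metis imageI minus_minus)
    moreover have "quat_j * quat_j = -1" "- quat_j * - quat_j = -1" by (simp_all add: quat_eq_iff)
    ultimately show False using mB B.mult by metis
  qed
  then obtain n where "qconj w ` A' = cyclic_Z n"
    using w(2) quat_j_in_models unfolding ade_model_def by (metis le_trans one_le_numeral)
  then have "qconj w ` A \<subseteq> cyclic_Z n" by (auto simp: A'_def)
  then have "qJ x = 0 \<and> qK x = 0" if "x \<in> qconj w ` A" for x
    using that by (auto simp: cyclic_Z_def)
  then have "{x \<in> qconj w ` A. qJ x = 0 \<and> qK x = 0} = qconj w ` A" by blast
  then obtain m where m: "m \<ge> 1" "qconj w ` A = cyclic_Z m" using B.complex_part_cyclic by metis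
  have "m \<noteq> 1"
  proof
    assume "m = 1"
    have "quat_of_complex (cis (2 * pi * real_of_int x / real 1)) = 1" for x
      by (simp add: quat_of_complex_def one_quat_def)
    then have "qconj w ` A \<subseteq> {1}" unfolding m(2) cyclic_Z_def \<open>m = 1\<close> by auto
    then have "x = 1" if "x \<in> A" for x
      using that w(1) by (metis image_subset_iff singletonD qconj_inverse qconj_one unit_qcnj)
    then show False using nontrivial one by blast
  qed
  then show ?thesis using m w(1) unfolding ade_model_def
    by (metis le_neq_implies_less Suc_leI numeral_2_eq_2 One_nat_def)
qed

section \<open>Free actions\<close>

lemma SU2_sel: "x \<otimes>\<^bsub>SU2\<^esub> y = x * y" "\<one>\<^bsub>SU2\<^esub> = 1"
  by (simp_all add: SU2_def)

lemma inv_SU2: "x \<in> unit_quaternions \<Longrightarrow> inv\<^bsub>SU2\<^esub> x = qcnj x"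
  by (rule group.inv_equality[OF group_SU2]) (simp_all add: SU2_sel carrier_SU2)

lemma SU2_cubed_sel:
  "(x, y, z) \<otimes>\<^bsub>SU2_cubed\<^esub> (x', y', z') = (x * x', y * y', z * z')"
  "\<one>\<^bsub>SU2_cubed\<^esub> = (1, 1, 1)"
  "carrier SU2_cubed = unit_quaternions \<times> unit_quaternions \<times> unit_quaternions"
  by (simp_all add: SU2_cubed_def SU2_sel carrier_SU2)

lemma inv_SU2_cubed:
  "x \<in> unit_quaternions \<Longrightarrow> y \<in> unit_quaternions \<Longrightarrow> z \<in> unit_quaternions \<Longrightarrow>
    inv\<^bsub>SU2_cubed\<^esub> (x, y, z) = (qcnj x, qcnj y, qcnj z)"
  by (simp add: SU2_cubed_def inv_DirProd group_SU2 DirProd_group carrier_SU2 inv_SU2)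

lemma finite_unit_group_of_subgroup:
  assumes "subgroup A SU2" "finite A"
  shows "finite_unit_group A"
proof
  show "finite A" by fact
  show "A \<subseteq> unit_quaternions" using subgroup.subset[OF assms(1)] by (simp add: carrier_SU2)
  show "1 \<in> A" using subgroup.one_closed[OF assms(1)] by (simp add: SU2_sel)
  show "x * y \<in> A" if "x \<in> A" "y \<in> A" for x y
    using subgroup.m_closed[OF assms(1) that] by (simp add: SU2_sel)
  show "qcnj x \<in> A" if "x \<in> A" for x
    using subgroup.m_inv_closed[OF assms(1) that] that \<open>A \<subseteq> unit_quaternions\<close>
    by (metis inv_SU2 subsetD)
qed

text \<open>Elements with equal real parts are conjugate to a common \<open>z\<close>, say \<open>a\<^sub>i v\<^sub>i = v\<^sub>i z\<close>. Then the
triple of the \<open>a\<^sub>i\<close> maps the coset of \<open>(v\<^sub>1, v\<^sub>2, v\<^sub>3)\<close> to itself.\<close>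

lemma free_action_no_common_qRe:
  assumes free: "acts_freely_on_M (A1 \<times> A2 \<times> A3)"
    and mem: "a1 \<in> A1" "a2 \<in> A2" "a3 \<in> A3"
    and u: "a1 \<in> unit_quaternions" "a2 \<in> unit_quaternions" "a3 \<in> unit_quaternions"
    and r: "qRe a1 = r" "qRe a2 = r" "qRe a3 = r"
  shows "r = 1"
proof (rule ccontr)
  assume "r \<noteq> 1"
  define z where "z = Quat r (sqrt (1 - r\<^sup>2)) 0 0"
  have ex: "\<exists>v\<in>unit_quaternions. a * v = v * z" if a: "a \<in> unit_quaternions" "qRe a = r" for a
  proof -
    obtain w where w: "w \<in> unit_quaternions" "qconj w a = z"
      using conj_imaginary_to_complex[OF a(1)] unfolding a(2) z_def by blast
    then have "qcnj w * z = a * qcnj w" by (simp add: qconj_def mult.assoc flip: w(2))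
    then show ?thesis using w(1) by (metis unit_qcnj)
  qed
  obtain v1 v2 v3 where v: "v1 \<in> unit_quaternions" "v2 \<in> unit_quaternions" "v3 \<in> unit_quaternions"
    "a1 * v1 = v1 * z" "a2 * v2 = v2 * z" "a3 * v3 = v3 * z"
    using ex[OF u(1) r(1)] ex[OF u(2) r(2)] ex[OF u(3) r(3)] by blast
  have zu: "z \<in> unit_quaternions"
  proof -
    have "z = qcnj v1 * (a1 * v1)" using v by simp
    moreover have "qcnj v1 * (a1 * v1) \<in> unit_quaternions"
      using v(1) u(1) by (intro unit_mult) simp_all
    ultimately show ?thesis by simp
  qed
  define X where "X = (v1, v2, v3) <#\<^bsub>SU2_cubed\<^esub> diagonal_SU2"
  have X: "X = (\<lambda>w. (v1 * w, v2 * w, v3 * w)) ` unit_quaternions"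
    by (auto simp: X_def l_coset_def diagonal_SU2_def SU2_cubed_sel carrier_SU2)
  have "X \<in> coset_space_M"
    unfolding coset_space_M_def LCOSETS_def X_def using v(1-3)
    by (intro UN_I[of "(v1, v2, v3)"]) (simp_all add: SU2_cubed_sel)
  moreover have "(a1, a2, a3) <#\<^bsub>SU2_cubed\<^esub> X = X"
  proof -
    have e: "a1 * (v1 * w) = v1 * (z * w)" "a2 * (v2 * w) = v2 * (z * w)" "a3 * (v3 * w) = v3 * (z * w)" for w
      by (simp_all add: v(4-6) flip: mult.assoc)
    have "(a1, a2, a3) <#\<^bsub>SU2_cubed\<^esub> X = (\<lambda>w. (v1 * w, v2 * w, v3 * w)) ` (\<lambda>w. z * w) ` unit_quaternions"
      by (simp add: X l_coset_def SU2_cubed_sel e image_image UNION_singleton_eq_range)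
    also have "(\<lambda>w. z * w) ` unit_quaternions = unit_quaternions"
    proof
      show "(\<lambda>w. z * w) ` unit_quaternions \<subseteq> unit_quaternions" using zu by auto
      show "unit_quaternions \<subseteq> (\<lambda>w. z * w) ` unit_quaternions"
      proof
        fix w assume "w \<in> unit_quaternions"
        then have "w = z * (qcnj z * w)" "qcnj z * w \<in> unit_quaternions" using zu by auto
        then show "w \<in> (\<lambda>w. z * w) ` unit_quaternions" by blast
      qed
    qed
    finally show ?thesis using X by simp
  qed
  ultimately have "(a1, a2, a3) = \<one>\<^bsub>SU2_cubed\<^esub>"
    using free mem unfolding acts_freely_on_M_def by blast
  then show False using r \<open>r \<noteq> 1\<close> by (simp add: SU2_cubed_sel)
qed

section \<open>Rotation angles occurring in the models\<close>

text \<open>For a set \<open>B\<close> of unit quaternions and \<open>p \<ge> 1\<close> this says that \<open>B\<close> contains a conjugate of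
\<open>exp (2\<pi>i/p)\<close>. It speaks of real parts because these are what a free action compares between
the factors.\<close>

definition has_order_element :: "nat \<Rightarrow> quat set \<Rightarrow> bool" where
  "has_order_element p B \<longleftrightarrow> cos (2 * pi / real p) \<in> qRe ` B"

lemma has_order_element_cyclic_Z:
  assumes "p dvd n" "n \<ge> 1"
  shows "has_order_element p (cyclic_Z n)"
proof -
  obtain k where n: "n = p * k" using assms(1) by blast
  have "2 * pi * real_of_int (int k) / real n = 2 * pi / real p" using assms(2) by (simp add: n)
  moreover have "quat_of_complex (cis (2 * pi * real_of_int (int k) / real n)) \<in> cyclic_Z n"
    unfolding cyclic_Z_def by blast
  ultimately have "quat_of_complex (cis (2 * pi / real p)) \<in> cyclic_Z n" by simp
  then show ?thesis unfolding has_order_element_def by (force simp: image_iff)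
qed

lemma has_order_element_two_D:
  assumes "p dvd 2 * n" "n \<ge> 1"
  shows "has_order_element p (two_D n)"
  using has_order_element_cyclic_Z[OF assms(1)] assms(2) unfolding two_D_eq has_order_element_def by auto

lemma has_order_element_exceptional:
  assumes "p = 2 \<or> p = 3"
  shows "has_order_element p two_T" "has_order_element p two_O"
    "has_order_element p two_I"
proof -
  have c3: "cos (2 * pi / 3) = -1/2"
    using cos_double_cos[of "pi / 3"] by (simp add: cos_60 power_divide)
  have "-1 \<in> two_T" "Quat (-1/2) (1/2) (1/2) (1/2) \<in> two_T"
    by (simp_all add: basis_in_two_T quat_basis_def half_in_two_T)
  then have "qRe (-1) \<in> qRe ` two_T" "qRe (Quat (-1/2) (1/2) (1/2) (1/2)) \<in> qRe ` two_T"
    by blast+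
  then show T: "has_order_element p two_T"
    using assms c3 unfolding has_order_element_def by auto
  show "has_order_element p two_O" "has_order_element p two_I"
    using T two_T_subset_two_I two_O_eq unfolding has_order_element_def by blast+
qed

lemma has_order_5_element_two_I: "has_order_element 5 two_I"
proof -
  have "cos (2 * pi / 5) = (golden_ratio - 1) / 2"
    using cos_double_cos[of "pi / 5"] golden_ratio_square
    by (simp add: cos_pi_fifth power2_eq_square field_simps)
  moreover have "icosian_q ^ 2 \<in> two_I"
    by (rule two_I_memI[of 2 1]) (simp_all add: basis_in_two_T quat_basis_def)
  then have "qRe (icosian_q ^ 2) \<in> qRe ` two_I" by blast
  ultimately show ?thesis by (simp only: has_order_element_def icosian_q_powers quat.sel of_nat_numeral)
qed

lemma cos_two_pi_div_neq_1:
  fixes p :: nat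
  assumes "p \<ge> 2"
  shows "cos (2 * pi / p) \<noteq> 1"
  using cos_monotone_0_pi[of 0 "2 * pi / p"] assms by (simp add: field_simps)

text \<open>In every product of the list the number of the second factor is at most that of the third.\<close>

definition ade_kind :: "nat \<Rightarrow> quat set \<Rightarrow> bool" where
  "ade_kind k B \<longleftrightarrow> (k = 0 \<and> (\<exists>n\<ge>2. B = cyclic_Z n)) \<or> (k = 1 \<and> (\<exists>n\<ge>2. B = two_D n)) \<or>
     (k = 2 \<and> B = two_T) \<or> (k = 3 \<and> B = two_O) \<or> (k = 4 \<and> B = two_I)"

lemma ade_model_kind: "ade_model B \<longleftrightarrow> (\<exists>k. ade_kind k B)"
  unfolding ade_model_def ade_kind_def by blast

inductive listed :: "(quat \<times> quat \<times> quat) set \<Rightarrow> bool" where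
  Z_I_I: "n \<ge> 2 \<Longrightarrow> \<not> 2 dvd n \<Longrightarrow> \<not> 3 dvd n \<Longrightarrow> \<not> 5 dvd n \<Longrightarrow> listed (cyclic_Z n \<times> two_I \<times> two_I)"
| Z_TO_TOI: "n \<ge> 2 \<Longrightarrow> \<not> 2 dvd n \<Longrightarrow> \<not> 3 dvd n \<Longrightarrow>
    B = two_T \<and> C = two_T \<or> B = two_T \<and> C = two_O \<or> B = two_T \<and> C = two_I \<or>
    B = two_O \<and> C = two_O \<or> B = two_O \<and> C = two_I \<Longrightarrow> listed (cyclic_Z n \<times> B \<times> C)"
| Z_Z_Z: "n \<ge> 2 \<Longrightarrow> m \<ge> 2 \<Longrightarrow> l \<ge> 2 \<Longrightarrow> gcd n (gcd m l) = 1 \<Longrightarrow>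
    listed (cyclic_Z n \<times> cyclic_Z m \<times> cyclic_Z l)"
| Z_Z_D: "n \<ge> 2 \<Longrightarrow> m \<ge> 2 \<Longrightarrow> l \<ge> 2 \<Longrightarrow> gcd n (gcd m (2 * l)) = 1 \<Longrightarrow>
    listed (cyclic_Z n \<times> cyclic_Z m \<times> two_D l)"
| Z_D_D: "n \<ge> 2 \<Longrightarrow> m \<ge> 2 \<Longrightarrow> l \<ge> 2 \<Longrightarrow> gcd n (gcd (2 * m) (2 * l)) = 1 \<Longrightarrow>
    listed (cyclic_Z n \<times> two_D m \<times> two_D l)"
| Z_Z_TO: "n \<ge> 2 \<Longrightarrow> m \<ge> 2 \<Longrightarrow> \<not> 2 dvd gcd n m \<Longrightarrow> \<not> 3 dvd gcd n m \<Longrightarrow>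
    C = two_T \<or> C = two_O \<Longrightarrow> listed (cyclic_Z n \<times> cyclic_Z m \<times> C)"
| Z_D_TOI: "n \<ge> 2 \<Longrightarrow> m \<ge> 2 \<Longrightarrow> \<not> 2 dvd gcd n (2 * m) \<Longrightarrow> \<not> 3 dvd gcd n (2 * m) \<Longrightarrow>
    C = two_T \<or> C = two_O \<or> C = two_I \<Longrightarrow> listed (cyclic_Z n \<times> two_D m \<times> C)"
| Z_Z_I: "n \<ge> 2 \<Longrightarrow> m \<ge> 2 \<Longrightarrow> \<not> 2 dvd gcd n m \<Longrightarrow> \<not> 3 dvd gcd n m \<Longrightarrow> \<not> 5 dvd gcd n m \<Longrightarrow>
    listed (cyclic_Z n \<times> cyclic_Z m \<times> two_I)"

text \<open>A number \<open>p \<ge> 2\<close> dividing \<open>n\<close> for which both other factors contain an element of order \<open>p\<close>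
gives the common real part \<open>cos (2\<pi>/p) \<noteq> 1\<close>. Applying this to the gcd itself shows that it is
1.\<close>

lemma listed_of_sorted_kinds:
  assumes n: "n \<ge> 2" and B: "ade_kind a B" and C: "ade_kind b C" and "a \<le> b"
    and disj: "\<And>r. r \<in> qRe ` cyclic_Z n \<Longrightarrow> r \<in> qRe ` B \<Longrightarrow> r \<in> qRe ` C \<Longrightarrow> r = 1"
  shows "listed (cyclic_Z n \<times> B \<times> C)"
proof -
  have no: False if "p \<ge> 2" "p dvd n" "has_order_element p B" "has_order_element p C" for p
    using disj[OF has_order_element_cyclic_Z[OF that(2), unfolded has_order_element_def]
        that(3,4)[unfolded has_order_element_def]] cos_two_pi_div_neq_1[OF that(1)] n by simp
  have gcd1: "gcd n l = 1" if "\<And>p. p \<ge> 2 \<Longrightarrow> p dvd n \<Longrightarrow> p dvd l \<Longrightarrow> False" for l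
  proof -
    have "gcd n l \<noteq> 0" using n by simp
    moreover have "\<not> 2 \<le> gcd n l" using that[of "gcd n l"] by auto
    ultimately show ?thesis by linarith
  qed
  note in_cyclic = has_order_element_cyclic_Z and in_D = has_order_element_two_D
    and in_TOI = has_order_element_exceptional and in_I = has_order_5_element_two_I
  from B consider (Z) m where "a = 0" "m \<ge> 2" "B = cyclic_Z m" | (D) m where "a = 1" "m \<ge> 2" "B = two_D m"
    | (T) "a = 2" "B = two_T" | (O) "a = 3" "B = two_O" | (I) "a = 4" "B = two_I"
    unfolding ade_kind_def by blast
  note B_cases = this
  from C consider (Z) l where "b = 0" "l \<ge> 2" "C = cyclic_Z l" | (D) l where "b = 1" "l \<ge> 2" "C = two_D l"
    | (T) "b = 2" "C = two_T" | (O) "b = 3" "C = two_O" | (I) "b = 4" "C = two_I"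
    unfolding ade_kind_def by blast
  note C_cases = this
  have BC: "has_order_element p X" if "X = two_T \<or> X = two_O \<or> X = two_I" "p = 2 \<or> p = 3" for X p
    using in_TOI[OF that(2)] that(1) by blast
  show ?thesis
  proof (cases rule: B_cases)
    case (Z m)
    have m1: "m \<ge> 1" using Z by simp
    have nom: False if "p \<ge> 2" "p dvd gcd n m" "has_order_element p C" for p
      using no[of p] that in_cyclic[of p m] m1 Z by simp
    show ?thesis
    proof (cases rule: C_cases)
      case (Z l)
      have "gcd n (gcd m l) = 1"
        by (rule gcd1, rule nom) (use Z in_cyclic in auto)
      then show ?thesis unfolding \<open>B = cyclic_Z m\<close> Z(3) by (rule listed.Z_Z_Z[OF n \<open>m \<ge> 2\<close> Z(2)])
    next
      case (D l)
      have "gcd n (gcd m (2 * l)) = 1"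
        by (rule gcd1, rule nom) (use D in_D in auto)
      then show ?thesis unfolding \<open>B = cyclic_Z m\<close> D(3) by (rule listed.Z_Z_D[OF n \<open>m \<ge> 2\<close> D(2)])
    next
      case T
      have "\<not> 2 dvd gcd n m" "\<not> 3 dvd gcd n m" using nom[of 2] nom[of 3] BC[of C] T by auto
      then show ?thesis unfolding \<open>B = cyclic_Z m\<close> using T(2) by (intro listed.Z_Z_TO n \<open>m \<ge> 2\<close>) simp_all
    next
      case O
      have "\<not> 2 dvd gcd n m" "\<not> 3 dvd gcd n m" using nom[of 2] nom[of 3] BC[of C] O by auto
      then show ?thesis unfolding \<open>B = cyclic_Z m\<close> using O(2) by (intro listed.Z_Z_TO n \<open>m \<ge> 2\<close>) simp_all
    next
      case I
      have "\<not> 2 dvd gcd n m" "\<not> 3 dvd gcd n m" using nom[of 2] nom[of 3] BC[of C] I by auto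
      moreover have "\<not> 5 dvd gcd n m" using nom[of 5] in_I I by auto
      ultimately show ?thesis unfolding \<open>B = cyclic_Z m\<close> I(2) by (rule listed.Z_Z_I[OF n \<open>m \<ge> 2\<close>])
    qed
  next
    case (D m)
    have m1: "m \<ge> 1" using D by simp
    have nom: False if "p \<ge> 2" "p dvd gcd n (2 * m)" "has_order_element p C" for p
      using no[of p] that in_D[of p m] m1 D by simp
    have TOI: ?thesis if C: "C = two_T \<or> C = two_O \<or> C = two_I"
    proof -
      have "\<not> 2 dvd gcd n (2 * m)" "\<not> 3 dvd gcd n (2 * m)" using nom[of 2] nom[of 3] BC[OF C] by auto
      then show ?thesis unfolding D(3) by (rule listed.Z_D_TOI[OF n D(2) _ _ C])
    qed
    show ?thesis
    proof (cases rule: C_cases)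
      case (Z l)
      then show ?thesis using \<open>a = 1\<close> \<open>a \<le> b\<close> by simp
    next
      case E: (D l)
      have "gcd n (gcd (2 * m) (2 * l)) = 1"
        by (rule gcd1, rule nom) (use E in_D in auto)
      then show ?thesis unfolding D(3) E(3) by (rule listed.Z_D_D[OF n D(2) E(2)])
    qed (use TOI in blast)+
  next
    case T
    then have "C = two_T \<or> C = two_O \<or> C = two_I" using C_cases \<open>a \<le> b\<close> by force
    moreover from this have "\<not> 2 dvd n" "\<not> 3 dvd n" using no[of 2] no[of 3] BC[of B] BC[of C] T by auto
    ultimately show ?thesis using T(2) by (intro listed.Z_TO_TOI n) auto
  next
    case O
    then have "C = two_O \<or> C = two_I" using C_cases \<open>a \<le> b\<close> by force
    moreover from this have "\<not> 2 dvd n" "\<not> 3 dvd n" using no[of 2] no[of 3] BC[of B] BC[of C] O by auto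
    ultimately show ?thesis using O(2) by (intro listed.Z_TO_TOI n) auto
  next
    case I
    then have C: "C = two_I" using C_cases \<open>a \<le> b\<close> by force
    then have "\<not> 2 dvd n" "\<not> 3 dvd n" using no[of 2] no[of 3] BC[of B] BC[of C] I by auto
    moreover have "\<not> 5 dvd n" using no[of 5] in_I C I by auto
    ultimately show ?thesis unfolding I(2) C by (rule listed.Z_I_I[OF n])
  qed
qed

section \<open>Assembling the list\<close>

lemma exists_permutation_123:
  assumes "{i, j, k} = {1, 2, 3 :: nat}"
  shows "\<exists>\<sigma>. \<sigma> permutes {1, 2, 3} \<and> \<sigma> 1 = i \<and> \<sigma> 2 = j \<and> \<sigma> 3 = k"
proof -
  define \<sigma> where "\<sigma> x = (if x = 1 then i else if x = 2 then j else if x = 3 then k else x)" for x :: nat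
  have s: "\<sigma> 1 = i" "\<sigma> 2 = j" "\<sigma> 3 = k" by (simp_all add: \<sigma>_def)
  have im: "\<sigma> ` {1, 2, 3} = {1, 2, 3}" by (simp only: image_insert image_empty s assms)
  then have "inj_on \<sigma> {1, 2, 3}" by (intro eq_card_imp_inj_on) simp_all
  then have "bij_betw \<sigma> {1, 2, 3} {1, 2, 3}" using im by (simp add: bij_betw_def)
  moreover have "\<sigma> x = x" if "x \<notin> {1, 2, 3}" for x using that by (simp add: \<sigma>_def)
  ultimately have "\<sigma> permutes {1, 2, 3}" by (rule bij_imp_permutes)
  then show ?thesis using s by blast
qed

lemma mem_product_iff_factor: "x \<in> F 1 \<times> F 2 \<times> F 3 \<longleftrightarrow> (\<forall>i\<in>{1, 2, 3}. factor x i \<in> F i)"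
  by (cases x) simp

lemma factor_permute_factors:
  "i \<in> {1, 2, 3} \<Longrightarrow> factor (permute_factors \<sigma> x) i = factor x (\<sigma> i)"
  by (auto simp: permute_factors_def)

lemma permute_factors_image:
  assumes "\<sigma> permutes {1, 2, 3}"
  shows "permute_factors \<sigma> ` (F 1 \<times> F 2 \<times> F 3) = F (\<sigma> 1) \<times> F (\<sigma> 2) \<times> F (\<sigma> 3)"
proof -
  have mem: "y \<in> F (\<sigma> 1) \<times> F (\<sigma> 2) \<times> F (\<sigma> 3) \<longleftrightarrow> (\<forall>i\<in>{1, 2, 3}. factor y i \<in> F (\<sigma> i))" for y
    by (rule mem_product_iff_factor[of y "\<lambda>i. F (\<sigma> i)"])
  show ?thesis
  proof (intro equalityI subsetI)
    fix y assume "y \<in> permute_factors \<sigma> ` (F 1 \<times> F 2 \<times> F 3)"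
    then obtain x where x: "y = permute_factors \<sigma> x" "\<forall>i\<in>{1, 2, 3}. factor x i \<in> F i"
      using mem_product_iff_factor by blast
    then show "y \<in> F (\<sigma> 1) \<times> F (\<sigma> 2) \<times> F (\<sigma> 3)"
      unfolding mem x(1) using factor_permute_factors permutes_in_image[OF assms] by metis
  next
    fix y assume y: "y \<in> F (\<sigma> 1) \<times> F (\<sigma> 2) \<times> F (\<sigma> 3)"
    define \<tau> where "\<tau> = inv_into UNIV \<sigma>"
    define x where "x = permute_factors \<tau> y"
    have i: "\<tau> i \<in> {1, 2, 3}" "\<sigma> (\<tau> i) = i" if "i \<in> {1, 2, 3}" for i
      using that permutes_in_image[OF permutes_inv[OF assms]] permutes_inverses(1)[OF assms] unfolding \<tau>_def by blast+
    have "\<forall>i\<in>{1, 2, 3}. factor x i \<in> F i"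
      unfolding x_def using y[unfolded mem] i factor_permute_factors by metis
    moreover have "permute_factors \<sigma> x = y"
    proof -
      have "factor x (\<sigma> i) = factor y i" if "i \<in> {1, 2, 3}" for i
        unfolding x_def using that factor_permute_factors permutes_in_image[OF assms]
          permutes_inverses(2)[OF assms, folded \<tau>_def] by metis
      then show ?thesis unfolding permute_factors_def by (cases y) simp
    qed
    ultimately show "y \<in> permute_factors \<sigma> ` (F 1 \<times> F 2 \<times> F 3)"
      using mem_product_iff_factor by blast
  qed
qed

text \<open>Conjugation in the product group acts factorwise, so the factors can be conjugated
independently after they have been permuted.\<close>

lemma equal_up_to_permutation_and_conjugation_factors:
  assumes \<sigma>: "\<sigma> permutes {1, 2, 3 :: nat}" and w: "\<And>i. i \<in> {1, 2, 3} \<Longrightarrow> w i \<in> unit_quaternions"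
  shows "equal_up_to_permutation_and_conjugation (F 1 \<times> F 2 \<times> F 3)
    (qconj (w (\<sigma> 1)) ` F (\<sigma> 1) \<times> qconj (w (\<sigma> 2)) ` F (\<sigma> 2) \<times> qconj (w (\<sigma> 3)) ` F (\<sigma> 3))"
proof -
  have u: "w (\<sigma> 1) \<in> unit_quaternions" "w (\<sigma> 2) \<in> unit_quaternions" "w (\<sigma> 3) \<in> unit_quaternions"
    using w permutes_in_image[OF \<sigma>] by simp_all
  define g where "g = (w (\<sigma> 1), w (\<sigma> 2), w (\<sigma> 3))"
  have g: "g \<in> carrier SU2_cubed" using u by (simp add: g_def SU2_cubed_sel)
  have "(\<lambda>x. g \<otimes>\<^bsub>SU2_cubed\<^esub> x \<otimes>\<^bsub>SU2_cubed\<^esub> inv\<^bsub>SU2_cubed\<^esub> g) (x, y, z) =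
    (qconj (w (\<sigma> 1)) x, qconj (w (\<sigma> 2)) y, qconj (w (\<sigma> 3)) z)" for x y z
    using u by (simp add: g_def SU2_cubed_sel inv_SU2_cubed qconj_def)
  then have "(\<lambda>x. g \<otimes>\<^bsub>SU2_cubed\<^esub> x \<otimes>\<^bsub>SU2_cubed\<^esub> inv\<^bsub>SU2_cubed\<^esub> g) ` (X \<times> Y \<times> Z) =
    qconj (w (\<sigma> 1)) ` X \<times> qconj (w (\<sigma> 2)) ` Y \<times> qconj (w (\<sigma> 3)) ` Z" for X Y Z
    by (force simp: image_iff)
  then show ?thesis
    unfolding equal_up_to_permutation_and_conjugation_def
    using \<sigma> g permute_factors_image[OF \<sigma>, of F] by metis
qed

lemma minus_one_in_non_cyclic: "ade_kind k B \<Longrightarrow> k \<noteq> 0 \<Longrightarrow> -1 \<in> qRe ` B"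
  using has_order_element_two_D[of 2] has_order_element_exceptional[of 2]
  unfolding ade_kind_def has_order_element_def by auto

theorem theorem3p5:
  fixes \<Gamma> :: "(quat \<times> quat \<times> quat) set"
  assumes "splittable \<Gamma>"
    and "acts_freely_on_M \<Gamma>"
  shows "\<exists>\<Gamma>'. equal_up_to_permutation_and_conjugation \<Gamma> \<Gamma>' \<and>
    ((\<exists>n\<ge>2. \<not> 2 dvd n \<and> \<not> 3 dvd n \<and> \<not> 5 dvd n \<and> \<Gamma>' = cyclic_Z n \<times> two_I \<times> two_I) \<or>
     (\<exists>n\<ge>2. \<not> 2 dvd n \<and> \<not> 3 dvd n \<and>
        (\<Gamma>' = cyclic_Z n \<times> two_O \<times> two_I \<or>
         \<Gamma>' = cyclic_Z n \<times> two_O \<times> two_O \<or>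
         \<Gamma>' = cyclic_Z n \<times> two_T \<times> two_O \<or>
         \<Gamma>' = cyclic_Z n \<times> two_T \<times> two_I \<or>
         \<Gamma>' = cyclic_Z n \<times> two_T \<times> two_T)) \<or>
     (\<exists>n\<ge>2. \<exists>m\<ge>2. \<exists>l\<ge>2. gcd n (gcd m l) = 1 \<and>
        \<Gamma>' = cyclic_Z n \<times> cyclic_Z m \<times> cyclic_Z l) \<or>
     (\<exists>n\<ge>2. \<exists>m\<ge>2. \<exists>l\<ge>2. gcd n (gcd m (2 * l)) = 1 \<and>
        \<Gamma>' = cyclic_Z n \<times> cyclic_Z m \<times> two_D l) \<or>
     (\<exists>n\<ge>2. \<exists>m\<ge>2. \<exists>l\<ge>2. gcd n (gcd (2 * m) (2 * l)) = 1 \<and>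
        \<Gamma>' = cyclic_Z n \<times> two_D m \<times> two_D l) \<or>
     (\<exists>n\<ge>2. \<exists>m\<ge>2. \<not> 2 dvd gcd n m \<and> \<not> 3 dvd gcd n m \<and>
        (\<Gamma>' = cyclic_Z n \<times> cyclic_Z m \<times> two_T \<or>
         \<Gamma>' = cyclic_Z n \<times> cyclic_Z m \<times> two_O)) \<or>
     (\<exists>n\<ge>2. \<exists>m\<ge>2. \<not> 2 dvd gcd n (2 * m) \<and> \<not> 3 dvd gcd n (2 * m) \<and>
        (\<Gamma>' = cyclic_Z n \<times> two_D m \<times> two_T \<or>
         \<Gamma>' = cyclic_Z n \<times> two_D m \<times> two_O \<or>
         \<Gamma>' = cyclic_Z n \<times> two_D m \<times> two_I)) \<or>
     (\<exists>n\<ge>2. \<exists>m\<ge>2. \<not> 2 dvd gcd n m \<and> \<not> 3 dvd gcd n m \<and> \<not> 5 dvd gcd n m \<and>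
        \<Gamma>' = cyclic_Z n \<times> cyclic_Z m \<times> two_I))"
    (is "\<exists>\<Gamma>'. _ \<and> ?list \<Gamma>'")
proof -
  obtain A1 A2 A3 where A: "subgroup A1 SU2" "subgroup A2 SU2" "subgroup A3 SU2"
    "A1 \<noteq> {1}" "A2 \<noteq> {1}" "A3 \<noteq> {1}" "\<Gamma> = A1 \<times> A2 \<times> A3" and fin: "finite \<Gamma>"
    using assms(1) unfolding splittable_def SU2_sel by blast
  define F where "F i = (if i = 1 then A1 else if i = 2 then A2 else A3)" for i :: nat
  have F: "F 1 = A1" "F 2 = A2" "F 3 = A3" by (simp_all add: F_def)
  have "1 \<in> A1" "1 \<in> A2" "1 \<in> A3"
    using subgroup.one_closed[OF A(1)] subgroup.one_closed[OF A(2)] subgroup.one_closed[OF A(3)]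
    by (simp_all add: SU2_sel)
  then have "finite A1" "finite A2" "finite A3"
    using fin unfolding A(7) by (auto simp: finite_cartesian_product_iff)
  then have group: "finite_unit_group (F i)" and nontrivial: "F i \<noteq> {1}" for i
    using A finite_unit_group_of_subgroup by (simp_all add: F_def)
  have "\<forall>i. \<exists>w. w \<in> unit_quaternions \<and> ade_model (qconj w ` F i)"
    using finite_unit_group.conj_to_ade_model_of_nontrivial[OF group nontrivial] by blast
  then obtain w where w: "\<And>i. w i \<in> unit_quaternions" "\<And>i. ade_model (qconj (w i) ` F i)"
    by metis
  define G where "G i = qconj (w i) ` F i" for i
  have reG: "qRe ` G i = qRe ` F i" for i
    using w(1) by (simp add: G_def image_image)
  obtain k where k: "\<And>i. ade_kind (k i) (G i)"
    using w(2) unfolding ade_model_kind G_def by metis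
  have common: "r = 1" if "r \<in> qRe ` G 1" "r \<in> qRe ` G 2" "r \<in> qRe ` G 3" for r
  proof -
    have "r \<in> qRe ` F 1" "r \<in> qRe ` F 2" "r \<in> qRe ` F 3" using that by (simp_all add: reG)
    then obtain a1 a2 a3 where a: "a1 \<in> F 1" "a2 \<in> F 2" "a3 \<in> F 3" "qRe a1 = r" "qRe a2 = r" "qRe a3 = r"
      by (metis imageE)
    show ?thesis
      by (rule free_action_no_common_qRe[OF assms(2)[unfolded A(7)] a(1-3)[unfolded F] _ _ _ a(4-6)])
        (rule finite_unit_group.is_unit[OF group], rule a)+
  qed
  \<comment> \<open>Otherwise \<open>-1\<close> would be a common real part; so one of the factors is cyclic of odd order.\<close>
  have "\<exists>i\<in>{1, 2, 3}. -1 \<notin> qRe ` G i" using common[of "-1"] by auto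
  then obtain i where i: "i \<in> {1, 2, 3}" "-1 \<notin> qRe ` G i" by blast
  then have "k i = 0" using minus_one_in_non_cyclic k by blast
  then obtain n where n: "n \<ge> 2" "G i = cyclic_Z n" using k[of i] unfolding ade_kind_def by auto
  obtain j l where jl: "{i, j, l} = {1, 2, 3}" "k j \<le> k l"
  proof -
    obtain j l where "{i, j, l} = {1, 2, 3}" using i(1) by blast
    then show ?thesis using that[of j l] that[of l j] by (metis insert_commute linear)
  qed
  obtain \<sigma> where \<sigma>: "\<sigma> permutes {1, 2, 3}" "\<sigma> 1 = i" "\<sigma> 2 = j" "\<sigma> 3 = l"
    using exists_permutation_123[OF jl(1)] by blast
  have all: "r \<in> qRe ` G 1 \<and> r \<in> qRe ` G 2 \<and> r \<in> qRe ` G 3"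
    if "r \<in> qRe ` G i" "r \<in> qRe ` G j" "r \<in> qRe ` G l" for r
  proof -
    have "\<forall>x\<in>{i, j, l}. r \<in> qRe ` G x" using that by simp
    then show ?thesis unfolding jl(1) by simp
  qed
  have listed: "listed (G i \<times> G j \<times> G l)"
    unfolding n(2)
    by (rule listed_of_sorted_kinds[OF n(1) k k jl(2)]) (use common all n(2) in blast)
  have equal: "equal_up_to_permutation_and_conjugation \<Gamma> (G i \<times> G j \<times> G l)"
    using equal_up_to_permutation_and_conjugation_factors[OF \<sigma>(1) w(1), of F]
    unfolding G_def F \<sigma> A(7) .
  have list: "?list \<Gamma>'" if "listed \<Gamma>'" for \<Gamma>'
    using that
    proof cases
      case Z_I_I
      show ?thesis by (rule disjI1, use Z_I_I in blast)
    next
      case (Z_TO_TOI n B C)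
      show ?thesis
        by (rule disjI2, rule disjI1, rule exI[of _ n], intro conjI Z_TO_TOI(2-4))
          (use Z_TO_TOI(5) in \<open>unfold Z_TO_TOI(1), elim disjE conjE; simp\<close>)
    next
      case (Z_Z_Z n m l)
      show ?thesis
        by (rule disjI2, rule disjI2, rule disjI1, rule exI[of _ n],
            rule conjI[OF Z_Z_Z(2)], rule exI[of _ m], rule conjI[OF Z_Z_Z(3)],
            rule exI[of _ l], intro conjI Z_Z_Z)
    next
      case (Z_Z_D n m l)
      show ?thesis
        by (rule disjI2, rule disjI2, rule disjI2, rule disjI1, rule exI[of _ n],
            rule conjI[OF Z_Z_D(2)], rule exI[of _ m], rule conjI[OF Z_Z_D(3)],
            rule exI[of _ l], intro conjI Z_Z_D)
    next
      case (Z_D_D n m l)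
      show ?thesis
        by (rule disjI2, rule disjI2, rule disjI2, rule disjI2,
            rule disjI1, rule exI[of _ n],
            rule conjI[OF Z_D_D(2)], rule exI[of _ m], rule conjI[OF Z_D_D(3)],
            rule exI[of _ l], intro conjI Z_D_D)
    next
      case (Z_Z_TO n m C)
      show ?thesis
        by (rule disjI2, rule disjI2, rule disjI2, rule disjI2,
            rule disjI2, rule disjI1, rule exI[of _ n],
            rule conjI[OF Z_Z_TO(2)], rule exI[of _ m], intro conjI Z_Z_TO(3-5))
          (use Z_Z_TO(6) in \<open>unfold Z_Z_TO(1), elim disjE; simp\<close>)
    next
      case (Z_D_TOI n m C)
      show ?thesis
        by (rule disjI2, rule disjI2, rule disjI2, rule disjI2,
            rule disjI2, rule disjI2, rule disjI1, rule exI[of _ n],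
            rule conjI[OF Z_D_TOI(2)], rule exI[of _ m], intro conjI Z_D_TOI(3-5))
          (use Z_D_TOI(6) in \<open>unfold Z_D_TOI(1), elim disjE; simp\<close>)
    next
      case (Z_Z_I n m)
      show ?thesis
        by (rule disjI2, rule disjI2, rule disjI2, rule disjI2,
            rule disjI2, rule disjI2, rule disjI2, rule exI[of _ n],
            rule conjI[OF Z_Z_I(2)], rule exI[of _ m], intro conjI Z_Z_I)
    qed
  show ?thesis by (rule exI, rule conjI, rule equal, rule list, rule listed)
qed

end
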